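(* Let $\Omega:=[0,1)$ with Borel $\sigma$-algebra $\mathcal{B}$, let $T:[0,1)\to[0,1)$, $T(x):=2x \bmod 1$, and let $\mu$ be the Lebesgue measure restricted to $[0,1)$. Let $\gamma>1$ and let $\chi:[0,1)\to\mathbb{R}_{>0}$ be given by $\chi(x)=x^{-\gamma}$ for $x\in(0,1)$ (with an arbitrary positive value at $0$). Then: (i) there exists a Banach space $\mathcal{F}$ with a norm $\|\cdot\|$ such that $([0,1),\mathcal{B},T,\mu,\mathcal{F},\|\cdot\|,\chi)$ fulfills Property $\mathfrak{D}$; (ii) if, on the other hand, $(b_n)_{n\in\mathbb{N}}$ is a sequence of natural numbers tending to infinity with $b_n=o(n)$, then $$\int\mathsf{S}_n^{b_n}\chi\,\mathrm{d}\mu=\infty$$ for all $n\in\mathbb{N}$.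
   Context: Here $\mathbb{N}=\{1,2,\dots\}$ and $\mathbb{N}_0=\mathbb{N}\cup\{0\}$. **Spectral gap.** A bounded linear operator $U:\mathcal{F}\to\mathcal{F}$ on a Banach space has a spectral gap if $U=\lambda P+N$ with $\lambda\in\mathbb{C}$ and $P,N$ bounded linear operators such that $P^2=P$ and $P$ has one-dimensional image, the spectral radius of $N$ satisfies $\rho(N)<|\lambda|$, and $PN=NP=0$. **Property $\mathfrak{C}$.** Let $(\Omega,\mathcal{A},T,\mu)$ be a dynamical system with $T$ a non-singular transformation, and let $\widehat{T}:\mathcal{L}^1\to\mathcal{L}^1$ be its transfer operator, i.e. the unique operator with $\int\widehat{T}f\cdot g\,\mathrm{d}\mu=\int f\cdot g\circ T\,\mathrm{d}\mu$ for all $f\in\mathcal{L}^1$, $g\in\mathcal{L}^\infty$. Let $\mathcal{F}$ be a subset of the measurable functions forming a Banach algebra with respect to the norm $\|\cdot\|$. Then $(\Omega,\mathcal{A},T,\mu,\mathcal{F},\|\cdot\|)$ has Property $\mathfrak{C}$ if: (1) $\mu$ is a $T$-invariant, mixing probability measure; (2) $\mathcal{F}$ contains the constant functions and $\|f\|\ge|f|_\infty$ for all $f\in\mathcal{F}$ (where $|\cdot|_\infty$ is the $\mathcal{L}^\infty$-norm); (3) $\widehat{T}$ is a bounded linear operator with respect to $\|\cdot\|$, i.e. there is a constant $K_0>0$ with $\|\widehat{T}f\|\le K_0\|f\|$ for all $f\in\mathcal{F}$; (4) $\widehat{T}$ acting on $(\mathcal{F},\|\cdot\|)$ has a spectral gap.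 **Property $\mathfrak{D}$.** $(\Omega,\mathcal{A},T,\mu,\mathcal{F},\|\cdot\|,\chi)$ has Property $\mathfrak{D}$ if $(\Omega,\mathcal{A},T,\mu,\mathcal{F},\|\cdot\|)$ has Property $\mathfrak{C}$, $\chi:\Omega\to\mathbb{R}_{\ge0}$ is $\mathcal{A}$-measurable, and there is $K_1>0$ such that for all $\ell\in\mathbb{R}_{\ge0}$: $\|\chi\cdot\mathbf{1}_{\{\chi\le\ell\}}\|\le K_1\cdot\ell$ and $\|\mathbf{1}_{\{\chi>\ell\}}\|\le K_1$. **Trimmed sums.** For $n\in\mathbb{N}$ and $b_n\in\mathbb{N}_0$, $\mathsf{S}_n^{b_n}\chi$ is the sum of the $n$ values $\chi,\chi\circ T,\dots,\chi\circ T^{n-1}$ with the $b_n$ largest of them removed: pointwise, if $\chi\circ T^{\sigma(1)}\ge\dots\ge\chi\circ T^{\sigma(n)}$ is a decreasing ordering, where $\sigma:\{1,\dots,n\}\to\{0,\dots,n-1\}$ is a (point-dependent) bijection, then $\mathsf{S}_n^{b_n}\chi=\sum_{k=b_n+1}^{n}\chi\circ T^{\sigma(k)}$.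
   Formalization: In (ii) the integral is shown to be infinite for every n with b_n < n, not for all n: when b_n ≥ n (always at n = 1 if b_1 ≥ 1) all terms are trimmed, the sum is empty and its integral is 0. *)

theory Defs
  imports "HOL-Probability.Probability" "HOL-Library.Landau_Symbols"
begin

text \<open>
  Function spaces are sets of measurable functions with values in the complex numbers, with
  functions agreeing almost everywhere identified (the transfer operator is only determined up to
  null sets). Instead of passing to quotients, a space \<open>F\<close> is required to be closed under
  a.e. equality, its norm only depends on the a.e. class, and equations between elements are read
  almost everywhere. The scalars are complex since the leading eigenvalue of a spectral gap is an
  arbitrary complex number.
\<close>

definition ae_eq :: "'a measure \<Rightarrow> ('a \<Rightarrow> complex) \<Rightarrow> ('a \<Rightarrow> complex) \<Rightarrow> bool" where
  "ae_eq M f g \<longleftrightarrow> (AE x in M. f x = g x)"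

definition function_banach_algebra ::
    "'a measure \<Rightarrow> ('a \<Rightarrow> complex) set \<Rightarrow> (('a \<Rightarrow> complex) \<Rightarrow> real) \<Rightarrow> bool" where
  "function_banach_algebra M F nrm \<longleftrightarrow>
     F \<subseteq> borel_measurable M \<and>
     (\<forall>f\<in>F. \<forall>g\<in>borel_measurable M. ae_eq M f g \<longrightarrow> g \<in> F \<and> nrm g = nrm f) \<and>
     (\<lambda>x. 0) \<in> F \<and>
     (\<forall>f\<in>F. \<forall>g\<in>F. (\<lambda>x. f x + g x) \<in> F) \<and>
     (\<forall>c. \<forall>f\<in>F. (\<lambda>x. c * f x) \<in> F) \<and>
     (\<forall>f\<in>F. \<forall>g\<in>F. (\<lambda>x. f x * g x) \<in> F) \<and>
     (\<forall>f\<in>F. 0 \<le> nrm f) \<and>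
     (\<forall>f\<in>F. nrm f = 0 \<longleftrightarrow> ae_eq M f (\<lambda>x. 0)) \<and>
     (\<forall>c. \<forall>f\<in>F. nrm (\<lambda>x. c * f x) = cmod c * nrm f) \<and>
     (\<forall>f\<in>F. \<forall>g\<in>F. nrm (\<lambda>x. f x + g x) \<le> nrm f + nrm g) \<and>
     (\<forall>f\<in>F. \<forall>g\<in>F. nrm (\<lambda>x. f x * g x) \<le> nrm f * nrm g) \<and>
     (\<forall>u :: nat \<Rightarrow> 'a \<Rightarrow> complex.
        range u \<subseteq> F \<longrightarrow>
        (\<forall>e>0. \<exists>n0. \<forall>m\<ge>n0. \<forall>n\<ge>n0. nrm (\<lambda>x. u m x - u n x) < e) \<longrightarrow>
        (\<exists>f\<in>F. (\<lambda>n. nrm (\<lambda>x. u n x - f x)) \<longlonglongrightarrow> 0))"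

text \<open>
  Linearity and boundedness together force an operator to respect a.e. equality.
\<close>

definition bounded_linear_op ::
    "'a measure \<Rightarrow> ('a \<Rightarrow> complex) set \<Rightarrow> (('a \<Rightarrow> complex) \<Rightarrow> real) \<Rightarrow>
     (('a \<Rightarrow> complex) \<Rightarrow> 'a \<Rightarrow> complex) \<Rightarrow> bool" where
  "bounded_linear_op M F nrm U \<longleftrightarrow>
     (\<forall>f\<in>F. U f \<in> F) \<and>
     (\<forall>f\<in>F. \<forall>g\<in>F. ae_eq M (U (\<lambda>x. f x + g x)) (\<lambda>x. U f x + U g x)) \<and>
     (\<forall>c. \<forall>f\<in>F. ae_eq M (U (\<lambda>x. c * f x)) (\<lambda>x. c * U f x)) \<and>
     (\<exists>K>0. \<forall>f\<in>F. nrm (U f) \<le> K * nrm f)"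

definition op_spectrum ::
    "'a measure \<Rightarrow> ('a \<Rightarrow> complex) set \<Rightarrow> (('a \<Rightarrow> complex) \<Rightarrow> real) \<Rightarrow>
     (('a \<Rightarrow> complex) \<Rightarrow> 'a \<Rightarrow> complex) \<Rightarrow> complex set" where
  "op_spectrum M F nrm U =
     {z. \<not> (\<exists>S. bounded_linear_op M F nrm S \<and>
            (\<forall>f\<in>F. ae_eq M (S (\<lambda>x. z * f x - U f x)) f \<and>
                    ae_eq M (\<lambda>x. z * S f x - U (S f) x) f))}"

definition op_spectral_radius ::
    "'a measure \<Rightarrow> ('a \<Rightarrow> complex) set \<Rightarrow> (('a \<Rightarrow> complex) \<Rightarrow> real) \<Rightarrow>
     (('a \<Rightarrow> complex) \<Rightarrow> 'a \<Rightarrow> complex) \<Rightarrow> ennreal" where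
  "op_spectral_radius M F nrm U = (SUP z\<in>op_spectrum M F nrm U. ennreal (cmod z))"

definition one_dim_image ::
    "'a measure \<Rightarrow> ('a \<Rightarrow> complex) set \<Rightarrow> (('a \<Rightarrow> complex) \<Rightarrow> 'a \<Rightarrow> complex) \<Rightarrow> bool" where
  "one_dim_image M F P \<longleftrightarrow>
     (\<exists>h\<in>F. \<not> ae_eq M h (\<lambda>x. 0) \<and>
        (\<exists>f\<in>F. ae_eq M (P f) h) \<and>
        (\<forall>f\<in>F. \<exists>c. ae_eq M (P f) (\<lambda>x. c * h x)))"

definition spectral_gap ::
    "'a measure \<Rightarrow> ('a \<Rightarrow> complex) set \<Rightarrow> (('a \<Rightarrow> complex) \<Rightarrow> real) \<Rightarrow>
     (('a \<Rightarrow> complex) \<Rightarrow> 'a \<Rightarrow> complex) \<Rightarrow> bool" where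
  "spectral_gap M F nrm U \<longleftrightarrow>
     bounded_linear_op M F nrm U \<and>
     (\<exists>lam P N.
        bounded_linear_op M F nrm P \<and>
        bounded_linear_op M F nrm N \<and>
        (\<forall>f\<in>F. ae_eq M (U f) (\<lambda>x. lam * P f x + N f x)) \<and>
        (\<forall>f\<in>F. ae_eq M (P (P f)) (P f)) \<and>
        one_dim_image M F P \<and>
        op_spectral_radius M F nrm N < ennreal (cmod lam) \<and>
        (\<forall>f\<in>F. ae_eq M (P (N f)) (\<lambda>x. 0) \<and> ae_eq M (N (P f)) (\<lambda>x. 0)))"

definition nonsingular :: "'a measure \<Rightarrow> ('a \<Rightarrow> 'a) \<Rightarrow> bool" where
  "nonsingular M T \<longleftrightarrow>
     T \<in> measurable M M \<and>
     (\<forall>A\<in>sets M. emeasure M (T -` A \<inter> space M) = 0 \<longleftrightarrow> emeasure M A = 0)"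

definition invariant_measure :: "'a measure \<Rightarrow> ('a \<Rightarrow> 'a) \<Rightarrow> bool" where
  "invariant_measure M T \<longleftrightarrow>
     T \<in> measurable M M \<and>
     (\<forall>A\<in>sets M. emeasure M (T -` A \<inter> space M) = emeasure M A)"

definition mixing :: "'a measure \<Rightarrow> ('a \<Rightarrow> 'a) \<Rightarrow> bool" where
  "mixing M T \<longleftrightarrow>
     (\<forall>A\<in>sets M. \<forall>B\<in>sets M.
        (\<lambda>n. measure M (A \<inter> ((T ^^ n) -` B \<inter> space M))) \<longlonglongrightarrow> measure M A * measure M B)"

definition ess_norm :: "'a measure \<Rightarrow> ('a \<Rightarrow> complex) \<Rightarrow> ereal" where
  "ess_norm M f = esssup M (\<lambda>x. ereal (cmod (f x)))"

text \<open>
  A version of the transfer operator; every \<open>transfer_op M T f\<close> is unique up to a.e. equality.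
\<close>

definition transfer_op :: "'a measure \<Rightarrow> ('a \<Rightarrow> 'a) \<Rightarrow> ('a \<Rightarrow> complex) \<Rightarrow> 'a \<Rightarrow> complex" where
  "transfer_op M T f =
     (SOME h. integrable M h \<and>
        (\<forall>g\<in>borel_measurable M. ess_norm M g < \<infinity> \<longrightarrow>
           (LINT x|M. h x * g x) = (LINT x|M. f x * g (T x))))"

definition property_C ::
    "'a measure \<Rightarrow> ('a \<Rightarrow> 'a) \<Rightarrow> ('a \<Rightarrow> complex) set \<Rightarrow> (('a \<Rightarrow> complex) \<Rightarrow> real) \<Rightarrow> bool" where
  "property_C M T F nrm \<longleftrightarrow>
     nonsingular M T \<and>
     function_banach_algebra M F nrm \<and>
     prob_space M \<and> invariant_measure M T \<and> mixing M T \<and>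
     (\<forall>c. (\<lambda>x. c) \<in> F) \<and>
     (\<forall>f\<in>F. ess_norm M f \<le> ereal (nrm f)) \<and>
     bounded_linear_op M F nrm (transfer_op M T) \<and>
     spectral_gap M F nrm (transfer_op M T)"

definition property_D ::
    "'a measure \<Rightarrow> ('a \<Rightarrow> 'a) \<Rightarrow> ('a \<Rightarrow> complex) set \<Rightarrow> (('a \<Rightarrow> complex) \<Rightarrow> real) \<Rightarrow>
     ('a \<Rightarrow> real) \<Rightarrow> bool" where
  "property_D M T F nrm chi \<longleftrightarrow>
     property_C M T F nrm \<and>
     chi \<in> borel_measurable M \<and>
     (\<forall>x\<in>space M. 0 \<le> chi x) \<and>
     (\<exists>K1>0. \<forall>l\<ge>0.
        (\<lambda>x. complex_of_real (chi x) * indicator {y. chi y \<le> l} x) \<in> F \<and>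
        nrm (\<lambda>x. complex_of_real (chi x) * indicator {y. chi y \<le> l} x) \<le> K1 * l \<and>
        indicator {y. chi y > l} \<in> F \<and>
        nrm (indicator {y. chi y > l}) \<le> K1)"

definition decreasing_ordering ::
    "('a \<Rightarrow> 'a) \<Rightarrow> ('a \<Rightarrow> real) \<Rightarrow> nat \<Rightarrow> 'a \<Rightarrow> (nat \<Rightarrow> nat) \<Rightarrow> bool" where
  "decreasing_ordering T chi n x \<sigma> \<longleftrightarrow>
     bij_betw \<sigma> {1..n} {0..<n} \<and>
     (\<forall>i\<in>{1..n}. \<forall>j\<in>{1..n}. i \<le> j \<longrightarrow> chi ((T ^^ \<sigma> j) x) \<le> chi ((T ^^ \<sigma> i) x))"

text \<open>
  The value does not depend on which decreasing ordering is chosen; it is \<open>0\<close> if \<open>n \<le> b\<close>.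
\<close>

definition trimmed_sum ::
    "('a \<Rightarrow> 'a) \<Rightarrow> ('a \<Rightarrow> real) \<Rightarrow> nat \<Rightarrow> nat \<Rightarrow> 'a \<Rightarrow> real" where
  "trimmed_sum T chi n b x =
     (let \<sigma> = (SOME \<sigma>. decreasing_ordering T chi n x \<sigma>)
      in \<Sum>k = b + 1..n. chi ((T ^^ \<sigma> k) x))"

definition unit_lebesgue :: "real measure" where
  "unit_lebesgue = restrict_space lborel {0..<1}"

definition doubling_map :: "real \<Rightarrow> real" where
  "doubling_map x = frac (2 * x)"

end

theory Submission
  imports Defs
begin

text \<open>
  For the first part the space is that of functions of bounded variation, taken modulo null sets.
  Its norm is the infimum of supremum plus variation over all versions of a function. Three facts
  about variation carry the argument.

  \<^item> A product satisfies the Leibniz rule \<open>Var (f g) \<le> |f| Var g + |g| Var f\<close>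
    (\<open>variation_le_mult\<close>), which makes the norm submultiplicative.
  \<^item> Supremum and variation are lower semicontinuous under pointwise limits, which makes the
    space complete (\<open>bv_space_complete\<close>).
  \<^item> The transfer operator averages \<open>f\<close> over the two inverse branches of the doubling map, whose
    images are adjacent intervals. So it maps variation \<open>V\<close> to at most \<open>V / 2\<close>
    (\<open>variation_le_doubling_transfer\<close>).

  A function differs from its mean by at most its variation. Hence the transfer operator minus the
  projection \<open>P\<close> to the mean contracts like \<open>2 (1/2)^k\<close>, and a Neumann series
  (\<open>op_spectral_radius_le_decay_rate\<close>) bounds the spectral radius of this remainder by \<open>1/2\<close>. As
  the transfer operator fixes constants, this is a spectral gap with leading eigenvalue \<open>1\<close>. The
  same contraction gives exponential decay of correlations for intervals, and a Dynkin argument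
  extends mixing to all Borel sets. The truncations of \<open>x^(-\<gamma>)\<close> at height \<open>l\<close> are products of two
  monotone functions, with values in \<open>[0, l]\<close> and \<open>[0, 1]\<close>, so their norm is at most \<open>3 l\<close>.

  For the second part, the singularity at the fixed point \<open>0\<close> defeats trimming: on \<open>(0, 2^(-n))\<close>
  the first \<open>n\<close> points of the orbit are \<open>x, 2 x, ..., 2^(n-1) x\<close>, and even the smallest of the \<open>n\<close>
  observations is at least \<open>1 / (2^n x)\<close>, which is not integrable
  (\<open>trimmed_sum_near_zero\<close>, \<open>nn_integral_trimmed_sum_infinite\<close>).
\<close>

section \<open>Neumann series in a function Banach algebra\<close>

lemma bounded_linear_op_facts:
  assumes U: "bounded_linear_op M F nrm U"
  shows op_in: "f \<in> F \<Longrightarrow> U f \<in> F"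
    and op_add: "f \<in> F \<Longrightarrow> g \<in> F \<Longrightarrow> ae_eq M (U (\<lambda>x. f x + g x)) (\<lambda>x. U f x + U g x)"
    and op_cmult: "f \<in> F \<Longrightarrow> ae_eq M (U (\<lambda>x. c * f x)) (\<lambda>x. c * U f x)"
  using conjunct1[OF U[unfolded bounded_linear_op_def]]
    conjunct1[OF conjunct2[OF U[unfolded bounded_linear_op_def]]]
    conjunct1[OF conjunct2[OF conjunct2[OF U[unfolded bounded_linear_op_def]]]]
  by simp_all

context
  fixes M :: "'a measure" and F :: "('a \<Rightarrow> complex) set" and nrm :: "('a \<Rightarrow> complex) \<Rightarrow> real"
  assumes fba: "function_banach_algebra M F nrm"
begin

lemma fba_facts:
  shows fba_meas: "f \<in> F \<Longrightarrow> f \<in> borel_measurable M"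
    and fba_ae_nrm: "f \<in> F \<Longrightarrow> g \<in> borel_measurable M \<Longrightarrow> ae_eq M f g \<Longrightarrow> nrm g = nrm f"
    and fba_zero: "(\<lambda>x. 0) \<in> F"
    and fba_add: "f \<in> F \<Longrightarrow> g \<in> F \<Longrightarrow> (\<lambda>x. f x + g x) \<in> F"
    and fba_cmult: "f \<in> F \<Longrightarrow> (\<lambda>x. c * f x) \<in> F"
    and nrm_nonneg: "f \<in> F \<Longrightarrow> 0 \<le> nrm f"
    and nrm_eq_0: "f \<in> F \<Longrightarrow> nrm f = 0 \<longleftrightarrow> ae_eq M f (\<lambda>x. 0)"
    and nrm_cmult: "f \<in> F \<Longrightarrow> nrm (\<lambda>x. c * f x) = cmod c * nrm f"
    and nrm_add: "f \<in> F \<Longrightarrow> g \<in> F \<Longrightarrow> nrm (\<lambda>x. f x + g x) \<le> nrm f + nrm g"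
  using fba unfolding function_banach_algebra_def by blast+

lemma fba_complete:
  fixes u :: "nat \<Rightarrow> 'a \<Rightarrow> complex"
  assumes "range u \<subseteq> F" "\<And>e. e > 0 \<Longrightarrow> \<exists>n0. \<forall>m\<ge>n0. \<forall>n\<ge>n0. nrm (\<lambda>x. u m x - u n x) < e"
  obtains f where "f \<in> F" "(\<lambda>n. nrm (\<lambda>x. u n x - f x)) \<longlonglongrightarrow> 0"
proof -
  have "\<forall>u :: nat \<Rightarrow> 'a \<Rightarrow> complex.
        range u \<subseteq> F \<longrightarrow>
        (\<forall>e>0. \<exists>n0. \<forall>m\<ge>n0. \<forall>n\<ge>n0. nrm (\<lambda>x. u m x - u n x) < e) \<longrightarrow>
        (\<exists>f\<in>F. (\<lambda>n. nrm (\<lambda>x. u n x - f x)) \<longlonglongrightarrow> 0)"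
    using fba unfolding function_banach_algebra_def by blast
  then show ?thesis using assms that by blast
qed

lemma fba_diff:
  assumes "f \<in> F" "g \<in> F" shows "(\<lambda>x. f x - g x) \<in> F"
  using fba_add[OF assms(1) fba_cmult[OF assms(2), of "-1"]] by simp

lemma nrm_diff:
  assumes "f \<in> F" "g \<in> F" shows "nrm (\<lambda>x. f x - g x) \<le> nrm f + nrm g"
  using nrm_add[OF assms(1) fba_cmult[OF assms(2), of "-1"]] nrm_cmult[OF assms(2), of "-1"] by simp

lemma nrm_diff_triangle:
  assumes "f \<in> F" "g \<in> F" "h \<in> F"
  shows "nrm (\<lambda>x. f x - h x) \<le> nrm (\<lambda>x. f x - g x) + nrm (\<lambda>x. g x - h x)"
  using nrm_add[OF fba_diff[OF assms(1,2)] fba_diff[OF assms(2,3)]] by simp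

lemma nrm_minus_commute:
  assumes "f \<in> F" "g \<in> F"
  shows "nrm (\<lambda>x. f x - g x) = nrm (\<lambda>x. g x - f x)"
  using nrm_cmult[OF fba_diff[OF assms], of "-1"] by (simp add: algebra_simps)

lemma ae_eq_iff_nrm:
  assumes "f \<in> F" "g \<in> F"
  shows "ae_eq M f g \<longleftrightarrow> nrm (\<lambda>x. f x - g x) = 0"
  using nrm_eq_0[OF fba_diff[OF assms]] by (simp add: ae_eq_def)

lemma nrm_cong: "f \<in> F \<Longrightarrow> g \<in> F \<Longrightarrow> ae_eq M f g \<Longrightarrow> nrm f = nrm g"
  using fba_ae_nrm fba_meas by metis

text \<open>
  Completeness in the form in which the Neumann series uses it. The sum of the series of steps
  also bounds the distance of the limit from the starting point.
\<close>

lemma geometric_steps_converge: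
  fixes u :: "nat \<Rightarrow> 'a \<Rightarrow> complex"
  assumes u: "\<And>n. u n \<in> F" and q: "0 \<le> q" "q < 1" and c: "0 \<le> c"
    and step: "\<And>n. nrm (\<lambda>x. u (Suc n) x - u n x) \<le> c * q ^ n"
  obtains g where "g \<in> F" "(\<lambda>n. nrm (\<lambda>x. u n x - g x)) \<longlonglongrightarrow> 0"
    "nrm (\<lambda>x. g x - u 0 x) \<le> c / (1 - q)"
proof -
  have far: "nrm (\<lambda>x. u (n + k) x - u n x) \<le> c * q ^ n / (1 - q)" for n k
  proof -
    have "nrm (\<lambda>x. u (n + k) x - u n x) \<le> (\<Sum>j<k. c * q ^ (n + j))"
    proof (induction k)
      case 0
      show ?case using nrm_eq_0[OF fba_zero] by (simp add: ae_eq_def)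
    next
      case (Suc k)
      then show ?case
        using nrm_diff_triangle[OF u[of "n + Suc k"] u[of "n + k"] u[of n]] step[of "n + k"] by simp
    qed
    also have "\<dots> = c * q ^ n * (\<Sum>j<k. q ^ j)"
      by (simp add: sum_distrib_left power_add mult.assoc)
    also have "\<dots> = c * q ^ n * ((1 - q ^ k) / (1 - q))"
      using q by (subst sum_gp_strict) auto
    also have "\<dots> \<le> c * q ^ n * (1 / (1 - q))"
      using q c by (intro mult_left_mono divide_right_mono) auto
    finally show ?thesis by simp
  qed
  have lim: "(\<lambda>n. c * q ^ n / (1 - q)) \<longlonglongrightarrow> c * 0 / (1 - q)"
    using q by (intro tendsto_intros LIMSEQ_realpow_zero) auto
  have cauchy: "\<exists>n0. \<forall>m\<ge>n0. \<forall>n\<ge>n0. nrm (\<lambda>x. u m x - u n x) < e" if "e > 0" for e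
  proof -
    have "eventually (\<lambda>n. c * q ^ n / (1 - q) < e / 2) sequentially"
      using order_tendstoD(2)[OF lim, of "e / 2"] that by simp
    then obtain n0 where n0: "c * q ^ n0 / (1 - q) < e / 2"
      by (auto simp: eventually_sequentially)
    have "nrm (\<lambda>x. u m x - u n x) < e" if "m \<ge> n0" "n \<ge> n0" for m n
    proof -
      have "nrm (\<lambda>x. u m x - u n0 x) < e / 2" "nrm (\<lambda>x. u n x - u n0 x) < e / 2"
        using order.strict_trans1[OF far n0, of "m - n0"] order.strict_trans1[OF far n0, of "n - n0"] that
        by simp_all
      then show ?thesis
        using nrm_diff_triangle[OF u[of m] u[of n0] u[of n]] nrm_minus_commute[OF u[of n0] u[of n]]
        by simp
    qed
    then show ?thesis by blast
  qed
  obtain g where g: "g \<in> F" "(\<lambda>n. nrm (\<lambda>x. u n x - g x)) \<longlonglongrightarrow> 0"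
    using fba_complete[of u] u cauchy by blast
  have "nrm (\<lambda>x. g x - u 0 x) \<le> nrm (\<lambda>x. u n x - g x) + c / (1 - q)" for n
    using nrm_diff_triangle[OF g(1) u[of n] u[of 0]] far[of 0 n] nrm_minus_commute[OF g(1) u[of n]]
    by simp
  moreover have "(\<lambda>n. nrm (\<lambda>x. u n x - g x) + c / (1 - q)) \<longlonglongrightarrow> 0 + c / (1 - q)"
    by (intro tendsto_intros g)
  ultimately have "nrm (\<lambda>x. g x - u 0 x) \<le> c / (1 - q)"
    by (intro LIMSEQ_le_const[where X = "\<lambda>n. nrm (\<lambda>x. u n x - g x) + c / (1 - q)"]) simp_all
  then show ?thesis by (rule that[OF g])
qed

lemma bounded_linear_op_diff:
  assumes U: "bounded_linear_op M F nrm U" and "f \<in> F" "g \<in> F"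
  shows "ae_eq M (U (\<lambda>x. f x - g x)) (\<lambda>x. U f x - U g x)"
proof -
  have "ae_eq M (U (\<lambda>x. f x + (-1) * g x)) (\<lambda>x. U f x + U (\<lambda>x. (-1) * g x) x)"
    "ae_eq M (U (\<lambda>x. (-1) * g x)) (\<lambda>x. (-1) * U g x)"
    by (rule op_add[OF U assms(2) fba_cmult[OF assms(3)]], rule op_cmult[OF U assms(3)])
  then show ?thesis unfolding ae_eq_def by eventually_elim simp
qed

lemma bounded_linear_op_cong:
  assumes U: "bounded_linear_op M F nrm U" and "f \<in> F" "g \<in> F" "ae_eq M f g"
  shows "ae_eq M (U f) (U g)"
proof -
  obtain K where K: "\<And>f. f \<in> F \<Longrightarrow> nrm (U f) \<le> K * nrm f" and UF: "\<And>f. f \<in> F \<Longrightarrow> U f \<in> F"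
    using U unfolding bounded_linear_op_def by blast
  have "nrm (\<lambda>x. U f x - U g x) = nrm (U (\<lambda>x. f x - g x))"
    using bounded_linear_op_diff[OF U assms(2,3)]
    by (intro nrm_cong[symmetric] fba_diff UF assms) (simp add: ae_eq_def)
  also have "\<dots> \<le> K * nrm (\<lambda>x. f x - g x)" by (intro K fba_diff assms)
  also have "\<dots> = 0" using ae_eq_iff_nrm assms by simp
  finally have "nrm (\<lambda>x. U f x - U g x) = 0"
    using nrm_nonneg[OF fba_diff[OF UF UF]] assms by (simp add: antisym)
  then show ?thesis using ae_eq_iff_nrm UF assms by simp
qed

text \<open>
  The iteration \<open>s \<mapsto> (f + N s) / z\<close>, started at \<open>0\<close>, has the partial sums of the Neumann
  series as its iterates and a solution of \<open>z g - N g = f\<close> as its limit.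
\<close>

lemma resolvent_equation_solvable:
  assumes N: "bounded_linear_op M F nrm N" and r: "0 \<le> r" "r < cmod z" and C: "0 \<le> C"
    and decay: "\<And>f k. f \<in> F \<Longrightarrow> nrm ((N ^^ k) f) \<le> C * r ^ k * nrm f" and f: "f \<in> F"
  shows "\<exists>g\<in>F. ae_eq M (\<lambda>x. z * g x - N g x) f \<and>
    nrm g \<le> C / cmod z / (1 - r / cmod z) * nrm f"
proof -
  obtain K where K: "\<And>f. f \<in> F \<Longrightarrow> nrm (N f) \<le> K * nrm f" and NF: "\<And>f. f \<in> F \<Longrightarrow> N f \<in> F"
    using N unfolding bounded_linear_op_def by blast
  have Npow: "(N ^^ k) f \<in> F" if "f \<in> F" for f k
    using that NF by (induction k) auto
  have z: "z \<noteq> 0" "cmod z > 0" using r by auto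
  define s where "s = rec_nat (\<lambda>x. 0 :: complex) (\<lambda>_ s x. inverse z * (f x + N s x))"
  have s0: "s 0 = (\<lambda>x. 0)" and sS: "s (Suc n) = (\<lambda>x. inverse z * (f x + N (s n) x))" for n
    by (simp_all add: s_def)
  have sF: "s n \<in> F" for n
    by (induction n) (auto simp: s0 sS intro!: fba_zero fba_cmult fba_add f NF)
  have N0: "ae_eq M (N (\<lambda>x. 0)) (\<lambda>x. 0)"
    using bounded_linear_op_diff[OF N f f] by (simp add: ae_eq_def)
  have dN: "ae_eq M (\<lambda>x. s (Suc n) x - s n x) (\<lambda>x. inverse z ^ Suc n * (N ^^ n) f x)" for n
  proof (induction n)
    case 0
    show ?case using N0 unfolding ae_eq_def by eventually_elim (simp add: s0 sS)
  next
    case (Suc n)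
    have "ae_eq M (N (\<lambda>x. s (Suc n) x - s n x)) (\<lambda>x. N (s (Suc n)) x - N (s n) x)"
      by (rule bounded_linear_op_diff[OF N sF sF])
    moreover have "ae_eq M (N (\<lambda>x. s (Suc n) x - s n x)) (N (\<lambda>x. inverse z ^ Suc n * (N ^^ n) f x))"
      by (rule bounded_linear_op_cong[OF N fba_diff[OF sF sF] fba_cmult[OF Npow[OF f]] Suc])
    moreover have "ae_eq M (N (\<lambda>x. inverse z ^ Suc n * (N ^^ n) f x))
        (\<lambda>x. inverse z ^ Suc n * N ((N ^^ n) f) x)"
      by (rule op_cmult[OF N Npow[OF f]])
    ultimately show ?case unfolding ae_eq_def
    proof eventually_elim
      case (elim x)
      then have "N (s (Suc n)) x - N (s n) x = inverse z ^ Suc n * N ((N ^^ n) f) x" by simp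
      then show ?case by (simp add: sS flip: right_diff_distrib)
    qed
  qed
  have step: "nrm (\<lambda>x. s (Suc n) x - s n x) \<le> C / cmod z * nrm f * (r / cmod z) ^ n" for n
  proof -
    have "nrm (\<lambda>x. s (Suc n) x - s n x) = nrm (\<lambda>x. inverse z ^ Suc n * (N ^^ n) f x)"
      by (intro nrm_cong dN fba_diff fba_cmult sF Npow f)
    also have "\<dots> = cmod (inverse z ^ Suc n) * nrm ((N ^^ n) f)"
      by (intro nrm_cmult Npow f)
    also have "\<dots> \<le> cmod (inverse z ^ Suc n) * (C * r ^ n * nrm f)"
      by (intro mult_left_mono decay f) auto
    also have "\<dots> = C / cmod z * nrm f * (r / cmod z) ^ n"
      by (simp add: norm_mult norm_power norm_inverse norm_divide divide_simps power_divide)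
    finally show ?thesis .
  qed
  obtain g where g: "g \<in> F" "(\<lambda>n. nrm (\<lambda>x. s n x - g x)) \<longlonglongrightarrow> 0"
    "nrm (\<lambda>x. g x - s 0 x) \<le> C / cmod z * nrm f / (1 - r / cmod z)"
    using geometric_steps_converge[of s "r / cmod z" "C / cmod z * nrm f"] sF step r C
      nrm_nonneg[OF f] z by (auto simp: divide_simps)
  \<comment> \<open>the defect \<open>z g - N g - f\<close> equals \<open>z (g - s (n + 1)) - N (g - s n)\<close> for every \<open>n\<close>\<close>
  have bound: "nrm (\<lambda>x. (z * g x - N g x) - f x) \<le>
      cmod z * nrm (\<lambda>x. s (Suc n) x - g x) + K * nrm (\<lambda>x. s n x - g x)" for n
  proof -
    have m1: "(\<lambda>x. (z * g x - N g x) - f x) \<in> F"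
      by (intro fba_diff fba_cmult g NF f)
    have m2: "(\<lambda>x. N (\<lambda>x. s n x - g x) x - z * (s (Suc n) x - g x)) \<in> F"
      by (intro fba_diff fba_cmult g NF f sF)
    have "ae_eq M (\<lambda>x. (z * g x - N g x) - f x) (\<lambda>x. N (\<lambda>x. s n x - g x) x - z * (s (Suc n) x - g x))"
      using bounded_linear_op_diff[OF N sF[of n] g(1)] unfolding ae_eq_def
      by eventually_elim (use z in \<open>simp add: sS right_diff_distrib flip: mult.assoc\<close>)
    then have "nrm (\<lambda>x. (z * g x - N g x) - f x) =
        nrm (\<lambda>x. N (\<lambda>x. s n x - g x) x - z * (s (Suc n) x - g x))"
      using m1 m2 nrm_cong by blast
    also have "\<dots> \<le> nrm (N (\<lambda>x. s n x - g x)) + nrm (\<lambda>x. z * (s (Suc n) x - g x))"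
      by (intro nrm_diff fba_diff fba_cmult g NF f sF)
    also have "\<dots> \<le> K * nrm (\<lambda>x. s n x - g x) + cmod z * nrm (\<lambda>x. s (Suc n) x - g x)"
      by (intro add_mono K fba_diff sF g order.refl eq_refl nrm_cmult)
    finally show ?thesis by simp
  qed
  have "(\<lambda>n. cmod z * nrm (\<lambda>x. s (Suc n) x - g x) + K * nrm (\<lambda>x. s n x - g x))
      \<longlonglongrightarrow> cmod z * 0 + K * 0"
    by (intro tendsto_intros g LIMSEQ_Suc)
  then have "nrm (\<lambda>x. (z * g x - N g x) - f x) \<le> cmod z * 0 + K * 0"
    using bound by (intro LIMSEQ_le_const) auto
  moreover have m: "(\<lambda>x. z * g x - N g x) \<in> F"
    by (rule fba_diff[OF fba_cmult[OF g(1)] NF[OF g(1)]])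
  ultimately have "nrm (\<lambda>x. (z * g x - N g x) - f x) = 0"
    using nrm_nonneg[OF fba_diff[OF m f]] by simp
  then have "ae_eq M (\<lambda>x. z * g x - N g x) f"
    by (simp add: ae_eq_iff_nrm[OF m f])
  then show ?thesis using g(1,3) by (intro bexI[of _ g]) (auto simp: s0)
qed

text \<open>
  The difference \<open>d\<close> of two solutions satisfies \<open>N d = z d\<close>, hence \<open>N^k d = z^k d\<close>. This is
  compatible with the decay of \<open>N^k\<close> at a rate below \<open>|z|\<close> only for \<open>d = 0\<close>.
\<close>

lemma resolvent_equation_unique:
  assumes N: "bounded_linear_op M F nrm N" and r: "0 \<le> r" "r < cmod z"
    and decay: "\<And>f k. f \<in> F \<Longrightarrow> nrm ((N ^^ k) f) \<le> C * r ^ k * nrm f"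
    and g: "g \<in> F" and h: "h \<in> F"
    and eq: "ae_eq M (\<lambda>x. z * g x - N g x) (\<lambda>x. z * h x - N h x)"
  shows "ae_eq M g h"
proof -
  have NF: "\<And>f. f \<in> F \<Longrightarrow> N f \<in> F"
    by (rule op_in[OF N])
  have Npow: "(N ^^ k) f \<in> F" if "f \<in> F" for f k
    using that NF by (induction k) auto
  define d where "d = (\<lambda>x. g x - h x)"
  have d: "d \<in> F" unfolding d_def by (intro fba_diff g h)
  have Nd: "ae_eq M (N d) (\<lambda>x. z * d x)"
    using bounded_linear_op_diff[OF N g h] eq unfolding ae_eq_def
  proof eventually_elim
    case (elim x)
    then have "N d x = N g x - N h x" by (simp add: d_def)
    moreover have "z * d x = N g x - N h x" using elim(2) by (simp add: d_def algebra_simps)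
    ultimately show ?case by simp
  qed
  have "ae_eq M ((N ^^ k) d) (\<lambda>x. z ^ k * d x)" for k
  proof (induction k)
    case (Suc k)
    have "ae_eq M (N ((N ^^ k) d)) (N (\<lambda>x. z ^ k * d x))"
      by (rule bounded_linear_op_cong[OF N Npow[OF d] fba_cmult[OF d] Suc])
    moreover have "ae_eq M (N (\<lambda>x. z ^ k * d x)) (\<lambda>x. z ^ k * N d x)"
      by (rule op_cmult[OF N d])
    ultimately show ?case using Nd unfolding ae_eq_def
      by eventually_elim simp
  qed (simp add: ae_eq_def)
  then have "cmod (z ^ k) * nrm d \<le> C * r ^ k * nrm d" for k
    using decay[OF d, of k] nrm_cmult[OF d, of "z ^ k"] nrm_cong[OF Npow[OF d] fba_cmult[OF d]]
    by metis
  then have "nrm d \<le> (C * nrm d) * (r / cmod z) ^ k" for k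
    using r order.strict_trans1[OF r]
    by (simp add: norm_power power_divide divide_simps mult.commute mult.left_commute)
  moreover have "(\<lambda>k. (C * nrm d) * (r / cmod z) ^ k) \<longlonglongrightarrow> (C * nrm d) * 0"
    using r order.strict_trans1[OF r] by (intro tendsto_intros LIMSEQ_realpow_zero) simp_all
  ultimately have "nrm d \<le> (C * nrm d) * 0"
    by (intro LIMSEQ_le_const) auto
  then have "nrm d = 0" using nrm_nonneg[OF d] by simp
  then show ?thesis using ae_eq_iff_nrm g h by (simp add: d_def)
qed

text \<open>
  One half of Gelfand's formula. Since the resolvent equation has exactly one solution up to null
  sets, an arbitrary choice of solutions is automatically linear and a two-sided inverse.
\<close>

lemma op_spectral_radius_le_decay_rate:
  assumes N: "bounded_linear_op M F nrm N" and r: "0 \<le> r" and C: "0 < C"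
    and decay: "\<And>f k. f \<in> F \<Longrightarrow> nrm ((N ^^ k) f) \<le> C * r ^ k * nrm f"
  shows "op_spectral_radius M F nrm N \<le> ennreal r"
proof -
  have "cmod z \<le> r" if "z \<in> op_spectrum M F nrm N" for z
  proof (rule ccontr)
    assume "\<not> cmod z \<le> r"
    then have z: "r < cmod z" by simp
    have NF: "\<And>f. f \<in> F \<Longrightarrow> N f \<in> F"
      and Nadd: "\<And>f g. f \<in> F \<Longrightarrow> g \<in> F \<Longrightarrow> ae_eq M (N (\<lambda>x. f x + g x)) (\<lambda>x. N f x + N g x)"
      and Ncm: "\<And>c f. f \<in> F \<Longrightarrow> ae_eq M (N (\<lambda>x. c * f x)) (\<lambda>x. c * N f x)"
      by (rule op_in[OF N], assumption, rule op_add[OF N], assumption+, rule op_cmult[OF N])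
    define B where "B = C / cmod z / (1 - r / cmod z)"
    have B: "B > 0"
    proof -
      have "r / cmod z < 1" using z r by (subst divide_less_eq_1_pos) auto
      then show ?thesis using C z r unfolding B_def by (intro divide_pos_pos) auto
    qed
    define S where "S f = (SOME g. g \<in> F \<and> ae_eq M (\<lambda>x. z * g x - N g x) f \<and> nrm g \<le> B * nrm f)" for f
    have S: "S f \<in> F \<and> ae_eq M (\<lambda>x. z * S f x - N (S f) x) f \<and> nrm (S f) \<le> B * nrm f" if "f \<in> F" for f
    proof -
      have "\<exists>g. g \<in> F \<and> ae_eq M (\<lambda>x. z * g x - N g x) f \<and> nrm g \<le> B * nrm f"
        using resolvent_equation_solvable[OF N r z _ decay that] C unfolding B_def by auto
      then show ?thesis unfolding S_def by (rule someI_ex)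
    qed
    have uniq: "ae_eq M (S f) g" if "f \<in> F" "g \<in> F" "ae_eq M (\<lambda>x. z * g x - N g x) f" for f g
    proof (rule resolvent_equation_unique[OF N r z decay])
      show "ae_eq M (\<lambda>x. z * S f x - N (S f) x) (\<lambda>x. z * g x - N g x)"
        using conjunct1[OF conjunct2[OF S[OF that(1)]]] that(3) unfolding ae_eq_def
        by eventually_elim simp
    qed (use S that in auto)
    have "bounded_linear_op M F nrm S"
      unfolding bounded_linear_op_def
    proof (intro conjI ballI allI exI[of _ B])
      fix f g assume fg: "f \<in> F" "g \<in> F"
      show "ae_eq M (S (\<lambda>x. f x + g x)) (\<lambda>x. S f x + S g x)"
      proof (rule uniq)
        show "ae_eq M (\<lambda>x. z * (S f x + S g x) - N (\<lambda>x. S f x + S g x) x) (\<lambda>x. f x + g x)"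
        proof -
          have "ae_eq M (\<lambda>x. z * S f x - N (S f) x) f" "ae_eq M (\<lambda>x. z * S g x - N (S g) x) g"
            "ae_eq M (N (\<lambda>x. S f x + S g x)) (\<lambda>x. N (S f) x + N (S g) x)"
            using S Nadd fg by auto
          then show ?thesis
            unfolding ae_eq_def by eventually_elim (simp add: algebra_simps)
        qed
      qed (use S fg in \<open>auto intro!: fba_add\<close>)
    next
      fix f c assume f: "f \<in> F"
      show "ae_eq M (S (\<lambda>x. c * f x)) (\<lambda>x. c * S f x)"
      proof (rule uniq)
        have "ae_eq M (\<lambda>x. z * S f x - N (S f) x) f" "ae_eq M (N (\<lambda>x. c * S f x)) (\<lambda>x. c * N (S f) x)"
          using S[OF f] Ncm by auto
        then show "ae_eq M (\<lambda>x. z * (c * S f x) - N (\<lambda>x. c * S f x) x) (\<lambda>x. c * f x)"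
          unfolding ae_eq_def by eventually_elim (simp add: algebra_simps flip: right_diff_distrib)
      qed (use S f in \<open>auto intro!: fba_cmult\<close>)
    qed (use S B in auto)
    moreover have "ae_eq M (S (\<lambda>x. z * f x - N f x)) f" if "f \<in> F" for f
      by (rule uniq) (use that in \<open>auto simp: ae_eq_def intro!: fba_diff fba_cmult NF\<close>)
    ultimately show False
      using that S unfolding op_spectrum_def by blast
  qed
  then show ?thesis
    unfolding op_spectral_radius_def by (intro SUP_least ennreal_leI) auto
qed

end

section \<open>Functions of bounded variation on the unit interval\<close>

definition ordered_points :: "nat \<Rightarrow> (nat \<Rightarrow> real) \<Rightarrow> bool" where
  "ordered_points n t \<longleftrightarrow> (\<forall>i\<le>n. t i \<in> {0..<1}) \<and> (\<forall>i<n. t i \<le> t (Suc i))"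

text \<open>
  A predicate for upper bounds of the total variation on \<open>[0,1)\<close> instead of the supremum itself, so
  that functions of infinite variation need no separate treatment.
\<close>

definition variation_le :: "(real \<Rightarrow> complex) \<Rightarrow> real \<Rightarrow> bool" where
  "variation_le g V \<longleftrightarrow>
     (\<forall>n t. ordered_points n t \<longrightarrow> (\<Sum>i<n. cmod (g (t (Suc i)) - g (t i))) \<le> V)"

lemma variation_leI:
  "(\<And>n t. ordered_points n t \<Longrightarrow> (\<Sum>i<n. cmod (g (t (Suc i)) - g (t i))) \<le> V) \<Longrightarrow> variation_le g V"
  by (simp add: variation_le_def)

lemma variation_leD:
  "variation_le g V \<Longrightarrow> ordered_points n t \<Longrightarrow> (\<Sum>i<n. cmod (g (t (Suc i)) - g (t i))) \<le> V"
  by (simp add: variation_le_def)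

lemma variation_le_nonneg: "variation_le g V \<Longrightarrow> 0 \<le> V"
  using variation_leD[of g V 0 "\<lambda>_. 0"] by (simp add: ordered_points_def)

lemma variation_le_mono: "variation_le g V \<Longrightarrow> V \<le> W \<Longrightarrow> variation_le g W"
  unfolding variation_le_def by (meson order_trans)

lemma variation_le_const: "variation_le (\<lambda>x. c) 0"
  by (simp add: variation_le_def)

lemma variation_le_add:
  assumes f: "variation_le f V" and g: "variation_le g W"
  shows "variation_le (\<lambda>x. f x + g x) (V + W)"
proof (rule variation_leI)
  fix n and t :: "nat \<Rightarrow> real"
  assume pts: "ordered_points n t"
  then have t: "i \<le> n \<Longrightarrow> t i \<in> {0..<1}" "i < n \<Longrightarrow> t i \<le> t (Suc i)" for i
    by (simp_all add: ordered_points_def)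
  have "(\<Sum>i<n. cmod (f (t (Suc i)) + g (t (Suc i)) - (f (t i) + g (t i))))
      \<le> (\<Sum>i<n. cmod (f (t (Suc i)) - f (t i)) + cmod (g (t (Suc i)) - g (t i)))"
    by (intro sum_mono norm_diff_triangle_ineq)
  also have "\<dots> \<le> V + W"
    using variation_leD[OF f pts] variation_leD[OF g pts] by (simp add: sum.distrib)
  finally show "(\<Sum>i<n. cmod (f (t (Suc i)) + g (t (Suc i)) - (f (t i) + g (t i)))) \<le> V + W" .
qed

text \<open>
  The Leibniz rule, from \<open>f(b) g(b) - f(a) g(a) = f(b) (g(b) - g(a)) + g(a) (f(b) - f(a))\<close>.
\<close>

lemma variation_le_mult:
  assumes f: "variation_le f V" "\<And>x. x \<in> {0..<1} \<Longrightarrow> cmod (f x) \<le> A"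
    and g: "variation_le g W" "\<And>x. x \<in> {0..<1} \<Longrightarrow> cmod (g x) \<le> B"
  shows "variation_le (\<lambda>x. f x * g x) (A * W + B * V)"
proof (rule variation_leI)
  fix n and t :: "nat \<Rightarrow> real"
  assume pts: "ordered_points n t"
  then have t: "i \<le> n \<Longrightarrow> t i \<in> {0..<1}" "i < n \<Longrightarrow> t i \<le> t (Suc i)" for i
    by (simp_all add: ordered_points_def)
  have A: "0 \<le> A" using f(2)[of 0] norm_ge_zero[of "f 0"] by (simp del: norm_ge_zero)
  have B: "0 \<le> B" using g(2)[of 0] norm_ge_zero[of "g 0"] by (simp del: norm_ge_zero)
  have "(\<Sum>i<n. cmod (f (t (Suc i)) * g (t (Suc i)) - f (t i) * g (t i)))
      \<le> (\<Sum>i<n. A * cmod (g (t (Suc i)) - g (t i)) + B * cmod (f (t (Suc i)) - f (t i)))"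
  proof (intro sum_mono)
    fix i assume i: "i \<in> {..<n}"
    have "f (t (Suc i)) * g (t (Suc i)) - f (t i) * g (t i) =
        f (t (Suc i)) * (g (t (Suc i)) - g (t i)) + g (t i) * (f (t (Suc i)) - f (t i))"
      by (simp add: algebra_simps)
    also have "cmod \<dots> \<le> cmod (f (t (Suc i))) * cmod (g (t (Suc i)) - g (t i))
        + cmod (g (t i)) * cmod (f (t (Suc i)) - f (t i))"
      by (metis norm_mult norm_triangle_ineq)
    also have "\<dots> \<le> A * cmod (g (t (Suc i)) - g (t i)) + B * cmod (f (t (Suc i)) - f (t i))"
      using i by (intro add_mono mult_right_mono f(2) g(2) t(1)) auto
    finally show "cmod (f (t (Suc i)) * g (t (Suc i)) - f (t i) * g (t i))
      \<le> A * cmod (g (t (Suc i)) - g (t i)) + B * cmod (f (t (Suc i)) - f (t i))" .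
  qed
  also have "\<dots> = A * (\<Sum>i<n. cmod (g (t (Suc i)) - g (t i))) + B * (\<Sum>i<n. cmod (f (t (Suc i)) - f (t i)))"
    by (simp add: sum.distrib sum_distrib_left)
  also have "\<dots> \<le> A * W + B * V"
    by (intro add_mono mult_left_mono variation_leD[OF f(1) pts] variation_leD[OF g(1) pts] A B)
  finally show "(\<Sum>i<n. cmod (f (t (Suc i)) * g (t (Suc i)) - f (t i) * g (t i))) \<le> A * W + B * V" .
qed

lemma variation_le_cmult:
  assumes "variation_le f V"
  shows "variation_le (\<lambda>x. c * f x) (cmod c * V)"
proof (rule variation_leI)
  fix n and t :: "nat \<Rightarrow> real"
  assume pts: "ordered_points n t"
  then have t: "i \<le> n \<Longrightarrow> t i \<in> {0..<1}" "i < n \<Longrightarrow> t i \<le> t (Suc i)" for i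
    by (simp_all add: ordered_points_def)
  have "(\<Sum>i<n. cmod (c * f (t (Suc i)) - c * f (t i))) = cmod c * (\<Sum>i<n. cmod (f (t (Suc i)) - f (t i)))"
    by (simp add: sum_distrib_left norm_mult flip: right_diff_distrib)
  then show "(\<Sum>i<n. cmod (c * f (t (Suc i)) - c * f (t i))) \<le> cmod c * V"
    using mult_left_mono[OF variation_leD[OF assms pts], of "cmod c"] by simp
qed

lemma variation_le_pointwise_limit:
  assumes f: "\<And>k. variation_le (f k) V" and lim: "\<And>x. x \<in> {0..<1} \<Longrightarrow> (\<lambda>k. f k x) \<longlonglongrightarrow> g x"
  shows "variation_le g V"
proof (rule variation_leI)
  fix n and t :: "nat \<Rightarrow> real"
  assume pts: "ordered_points n t"
  then have t: "i \<le> n \<Longrightarrow> t i \<in> {0..<1}" "i < n \<Longrightarrow> t i \<le> t (Suc i)" for i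
    by (simp_all add: ordered_points_def)
  have "(\<lambda>k. \<Sum>i<n. cmod (f k (t (Suc i)) - f k (t i))) \<longlonglongrightarrow> (\<Sum>i<n. cmod (g (t (Suc i)) - g (t i)))"
    by (intro tendsto_intros lim t) auto
  then show "(\<Sum>i<n. cmod (g (t (Suc i)) - g (t i))) \<le> V"
    using variation_leD[OF f pts] by (intro LIMSEQ_le_const2) auto
qed

lemma variation_le_dist:
  assumes "variation_le g V" "x \<in> {0..<1}" "y \<in> {0..<1}"
  shows "cmod (g x - g y) \<le> V"
proof -
  have "cmod (g b - g a) \<le> V" if "a \<le> b" "a \<in> {0..<1}" "b \<in> {0..<1}" for a b
    using variation_leD[OF assms(1), of 1 "\<lambda>i. if i = 0 then a else b"] that by (auto simp: ordered_points_def)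
  then show ?thesis using assms(2,3) by (metis linear norm_minus_commute)
qed

text \<open>
  For a monotone function the sum over any partition telescopes.
\<close>

lemma variation_le_mono_on:
  fixes u :: "real \<Rightarrow> real"
  assumes "mono_on {0..<1} u" "\<And>x. x \<in> {0..<1} \<Longrightarrow> u x \<in> {0..c}"
  shows "variation_le (\<lambda>x. of_real (u x)) c"
proof (rule variation_leI)
  fix n and t :: "nat \<Rightarrow> real"
  assume pts: "ordered_points n t"
  then have t: "i \<le> n \<Longrightarrow> t i \<in> {0..<1}" "i < n \<Longrightarrow> t i \<le> t (Suc i)" for i
    by (simp_all add: ordered_points_def)
  have "(\<Sum>i<n. cmod (of_real (u (t (Suc i))) - of_real (u (t i)))) = (\<Sum>i<n. u (t (Suc i)) - u (t i))"
  proof (intro sum.cong refl)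
    fix i assume "i \<in> {..<n}"
    then have "u (t i) \<le> u (t (Suc i))" using t by (intro mono_onD[OF assms(1)]) auto
    then show "cmod (of_real (u (t (Suc i))) - of_real (u (t i))) = u (t (Suc i)) - u (t i)"
      by (simp add: norm_of_real flip: of_real_diff)
  qed
  also have "\<dots> = u (t n) - u (t 0)" by (rule sum_lessThan_telescope)
  also have "\<dots> \<le> c" using assms(2)[OF t(1)[of n]] assms(2)[OF t(1)[of 0]] by simp
  finally show "(\<Sum>i<n. cmod (of_real (u (t (Suc i))) - of_real (u (t i)))) \<le> c" .
qed

lemma variation_le_antimono_on:
  fixes u :: "real \<Rightarrow> real"
  assumes "antimono_on {0..<1} u" "\<And>x. x \<in> {0..<1} \<Longrightarrow> u x \<in> {0..c}"
  shows "variation_le (\<lambda>x. of_real (u x)) c"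
proof -
  have "variation_le (\<lambda>x. of_real (c - u x)) c"
    using assms by (intro variation_le_mono_on) (auto simp: monotone_on_def)
  from variation_le_add[OF variation_le_const[of "of_real c"] variation_le_cmult[OF this, of "-1"]]
  show ?thesis by (simp add: of_real_diff)
qed

section \<open>The Banach algebra of functions of bounded variation modulo null sets\<close>

lemma space_unit_lebesgue [simp]: "space unit_lebesgue = {0..<1}"
  by (simp add: unit_lebesgue_def space_restrict_space)

lemma prob_space_unit_lebesgue: "prob_space unit_lebesgue"
  by (rule prob_spaceI) (simp add: unit_lebesgue_def emeasure_restrict_space space_restrict_space)

interpretation U: prob_space unit_lebesgue
  by (rule prob_space_unit_lebesgue)

text \<open>
  Elements of the space only matter up to null sets, whereas variation depends on every value. All
  estimates are therefore made on a version \<open>g\<close> of \<open>f\<close> with explicit bounds \<open>A\<close> and \<open>V\<close> for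
  supremum and variation.
\<close>

definition bv_version :: "(real \<Rightarrow> complex) \<Rightarrow> (real \<Rightarrow> complex) \<Rightarrow> real \<Rightarrow> real \<Rightarrow> bool" where
  "bv_version f g A V \<longleftrightarrow>
     g \<in> borel_measurable unit_lebesgue \<and> ae_eq unit_lebesgue f g \<and>
     (\<forall>x\<in>{0..<1}. cmod (g x) \<le> A) \<and> variation_le g V"

definition bv_space :: "(real \<Rightarrow> complex) set" where
  "bv_space = {f \<in> borel_measurable unit_lebesgue. \<exists>g A V. bv_version f g A V}"

text \<open>
  The quotient norm of supremum plus variation modulo functions vanishing almost everywhere.
\<close>

definition bv_norm :: "(real \<Rightarrow> complex) \<Rightarrow> real" where
  "bv_norm f = Inf {A + V | g A V. bv_version f g A V}"

lemma bv_version_nonneg: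
  assumes "bv_version f g A V"
  shows "0 \<le> A" "0 \<le> V"
proof -
  have "cmod (g 0) \<le> A" using assms by (simp add: bv_version_def)
  then show "0 \<le> A" using norm_ge_zero order_trans by blast
  show "0 \<le> V" using assms variation_le_nonneg unfolding bv_version_def by blast
qed

lemma bv_norm_le:
  assumes "bv_version f g A V"
  shows "bv_norm f \<le> A + V"
  unfolding bv_norm_def
proof (rule cInf_lower)
  show "bdd_below {A + V |g A V. bv_version f g A V}"
  proof (rule bdd_belowI)
    fix s assume "s \<in> {A + V |g A V. bv_version f g A V}"
    then obtain g A V where "s = A + V" "bv_version f g A V" by blast
    then show "0 \<le> s" using bv_version_nonneg[of f g A V] by simp
  qed
qed (use assms in blast)

text \<open>
  Inequalities pass from versions to the norm, so that estimates may be made on one version at a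
  time.
\<close>

lemma le_bv_normI:
  assumes f: "f \<in> bv_space" and k: "0 \<le> k"
    and le: "\<And>g A V. bv_version f g A V \<Longrightarrow> z \<le> k * (A + V)"
  shows "z \<le> k * bv_norm f"
proof (cases "k = 0")
  case True
  then show ?thesis using f le by (fastforce simp: bv_space_def)
next
  case False
  have "z / k \<le> bv_norm f"
    unfolding bv_norm_def
  proof (rule cInf_greatest)
    show "{A + V |g A V. bv_version f g A V} \<noteq> {}" using f by (auto simp: bv_space_def)
    show "z / k \<le> s" if "s \<in> {A + V |g A V. bv_version f g A V}" for s
      using that le False k by (fastforce simp: divide_le_eq mult.commute)
  qed
  then show ?thesis using False k by (simp add: divide_le_eq mult.commute)
qed

lemma bv_norm_less_obtain:
  assumes "f \<in> bv_space" "bv_norm f < c"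
  obtains g A V where "bv_version f g A V" "A + V < c"
proof (rule ccontr)
  assume "\<not> thesis"
  then have "c \<le> A + V" if "bv_version f g A V" for g A V
    using \<open>bv_version f g A V \<Longrightarrow> A + V < c \<Longrightarrow> thesis\<close> that not_less by blast
  then have "c \<le> 1 * bv_norm f"
    using assms(1) by (intro le_bv_normI) auto
  then show False using assms(2) by simp
qed

lemma bv_norm_nonneg: "f \<in> bv_space \<Longrightarrow> 0 \<le> bv_norm f"
  using le_bv_normI[of f 1 0] bv_version_nonneg by (force intro: add_nonneg_nonneg)

lemma bv_version_cong:
  assumes "ae_eq unit_lebesgue f f'"
  shows "bv_version f g A V \<longleftrightarrow> bv_version f' g A V"
proof -
  have "ae_eq unit_lebesgue f g \<longleftrightarrow> ae_eq unit_lebesgue f' g"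
    using assms unfolding ae_eq_def
    by (intro iffI; elim AE_mp; elim AE_mp) (auto intro: AE_I2)
  then show ?thesis by (simp add: bv_version_def)
qed

lemma bv_version_const: "bv_version (\<lambda>x. c) (\<lambda>x. c) (cmod c) 0"
  by (simp add: bv_version_def ae_eq_def variation_le_const)

lemma bv_version_add:
  assumes "bv_version f g A V" "bv_version f' g' A' V'"
  shows "bv_version (\<lambda>x. f x + f' x) (\<lambda>x. g x + g' x) (A + A') (V + V')"
  using assms unfolding bv_version_def
  by (auto simp: ae_eq_def intro!: variation_le_add norm_triangle_le add_mono elim: eventually_elim2)

lemma bv_version_cmult:
  assumes "bv_version f g A V"
  shows "bv_version (\<lambda>x. c * f x) (\<lambda>x. c * g x) (cmod c * A) (cmod c * V)"
  using assms unfolding bv_version_def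
  by (auto simp: ae_eq_def norm_mult intro!: variation_le_cmult mult_left_mono)

lemma bv_version_mult:
  assumes f: "bv_version f g A V" and f': "bv_version f' g' A' V'"
  shows "bv_version (\<lambda>x. f x * f' x) (\<lambda>x. g x * g' x) (A * A') (A * V' + A' * V)"
  using assms bv_version_nonneg[OF f] bv_version_nonneg[OF f'] unfolding bv_version_def
  by (auto simp: ae_eq_def norm_mult intro!: variation_le_mult mult_mono elim: eventually_elim2)

lemma bv_spaceI:
  "f \<in> borel_measurable unit_lebesgue \<Longrightarrow> bv_version f g A V \<Longrightarrow> f \<in> bv_space"
  unfolding bv_space_def by blast

lemma bv_spaceE:
  assumes "f \<in> bv_space"
  obtains g A V where "bv_version f g A V"
  using assms unfolding bv_space_def by blast

lemma bv_space_measurable: "f \<in> bv_space \<Longrightarrow> f \<in> borel_measurable unit_lebesgue"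
  by (simp add: bv_space_def)

lemma bv_space_const: "(\<lambda>x. c) \<in> bv_space"
  by (rule bv_spaceI[OF _ bv_version_const]) simp

lemma bv_space_add: "f \<in> bv_space \<Longrightarrow> g \<in> bv_space \<Longrightarrow> (\<lambda>x. f x + g x) \<in> bv_space"
  unfolding bv_space_def by (auto intro: bv_version_add)

lemma bv_space_cmult: "f \<in> bv_space \<Longrightarrow> (\<lambda>x. c * f x) \<in> bv_space"
  unfolding bv_space_def by (auto intro: bv_version_cmult)

lemma bv_space_mult: "f \<in> bv_space \<Longrightarrow> g \<in> bv_space \<Longrightarrow> (\<lambda>x. f x * g x) \<in> bv_space"
  unfolding bv_space_def by (auto intro: bv_version_mult)

lemma bv_space_diff: "f \<in> bv_space \<Longrightarrow> g \<in> bv_space \<Longrightarrow> (\<lambda>x. f x - g x) \<in> bv_space"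
  using bv_space_add[OF _ bv_space_cmult[of g "-1"], of f] by simp

lemma bv_norm_add:
  assumes f: "f \<in> bv_space" and g: "g \<in> bv_space"
  shows "bv_norm (\<lambda>x. f x + g x) \<le> bv_norm f + bv_norm g"
proof -
  have "bv_norm (\<lambda>x. f x + g x) - bv_norm g \<le> 1 * bv_norm f"
  proof (rule le_bv_normI[OF f])
    fix f' A V assume f': "bv_version f f' A V"
    have "bv_norm (\<lambda>x. f x + g x) - (A + V) \<le> 1 * bv_norm g"
      using bv_norm_le[OF bv_version_add[OF f']] by (intro le_bv_normI[OF g]) fastforce+
    then show "bv_norm (\<lambda>x. f x + g x) - bv_norm g \<le> 1 * (A + V)" by simp
  qed simp
  then show ?thesis by simp
qed

text \<open>
  By the Leibniz rule the product of versions has the bound \<open>A B + A W + B V\<close>, which lacks only the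
  term \<open>V W\<close> of \<open>(A + V) (B + W)\<close>.
\<close>

lemma bv_norm_mult:
  assumes f: "f \<in> bv_space" and g: "g \<in> bv_space"
  shows "bv_norm (\<lambda>x. f x * g x) \<le> bv_norm f * bv_norm g"
proof -
  have "bv_norm (\<lambda>x. f x * g x) \<le> bv_norm g * bv_norm f"
  proof (rule le_bv_normI[OF f bv_norm_nonneg[OF g]])
    fix f' A V assume f': "bv_version f f' A V"
    have "bv_norm (\<lambda>x. f x * g x) \<le> (A + V) * bv_norm g"
    proof (rule le_bv_normI[OF g])
      show "0 \<le> A + V" using bv_version_nonneg[OF f'] by simp
      fix g' B W assume g': "bv_version g g' B W"
      have "bv_norm (\<lambda>x. f x * g x) \<le> A * B + (A * W + B * V)"
        by (rule bv_norm_le[OF bv_version_mult[OF f' g']])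
      also have "\<dots> \<le> (A + V) * (B + W)"
        using bv_version_nonneg[OF f'] bv_version_nonneg[OF g'] by (simp add: algebra_simps)
      finally show "bv_norm (\<lambda>x. f x * g x) \<le> (A + V) * (B + W)" .
    qed
    then show "bv_norm (\<lambda>x. f x * g x) \<le> bv_norm g * (A + V)" by (simp add: mult.commute)
  qed
  then show ?thesis by (simp add: mult.commute)
qed

lemma bv_norm_cmult_le:
  assumes f: "f \<in> bv_space"
  shows "bv_norm (\<lambda>x. c * f x) \<le> cmod c * bv_norm f"
  using bv_norm_le[OF bv_version_cmult] by (intro le_bv_normI[OF f]) (fastforce simp: algebra_simps)+

lemma bv_norm_cmult:
  assumes f: "f \<in> bv_space"
  shows "bv_norm (\<lambda>x. c * f x) = cmod c * bv_norm f"
proof (rule antisym[OF bv_norm_cmult_le[OF f]])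
  show "cmod c * bv_norm f \<le> bv_norm (\<lambda>x. c * f x)"
  proof (cases "c = 0")
    case True
    then show ?thesis using bv_norm_nonneg[OF bv_space_const[of 0]] by simp
  next
    case False
    then show ?thesis
      using bv_norm_cmult_le[OF bv_space_cmult[OF f, of c], of "inverse c"]
      by (simp add: norm_inverse norm_divide field_simps)
  qed
qed

lemma bv_norm_minus_commute:
  "f \<in> bv_space \<Longrightarrow> g \<in> bv_space \<Longrightarrow> bv_norm (\<lambda>x. f x - g x) = bv_norm (\<lambda>x. g x - f x)"
  using bv_norm_cmult[OF bv_space_diff, of f g "-1"] by simp

lemma ess_norm_le_bv_norm:
  assumes f: "f \<in> bv_space"
  shows "ess_norm unit_lebesgue f \<le> ereal (bv_norm f)"
proof (rule ccontr)
  assume "\<not> ess_norm unit_lebesgue f \<le> ereal (bv_norm f)"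
  then obtain r where r: "bv_norm f < r" "ereal r < ess_norm unit_lebesgue f"
    using ereal_dense2[of "ereal (bv_norm f)" "ess_norm unit_lebesgue f"] by (auto simp: not_le)
  obtain g A V where g: "bv_version f g A V" "A + V < r"
    using bv_norm_less_obtain[OF f r(1)] .
  have "AE x in unit_lebesgue. cmod (g x) \<le> A"
    using g(1) by (intro AE_I2) (simp add: bv_version_def)
  moreover have "AE x in unit_lebesgue. f x = g x"
    using g(1) by (simp add: bv_version_def ae_eq_def)
  ultimately have "AE x in unit_lebesgue. ereal (cmod (f x)) \<le> ereal r"
    by eventually_elim (use g bv_version_nonneg[OF g(1)] in simp)
  then have "ess_norm unit_lebesgue f \<le> ereal r"
    unfolding ess_norm_def using bv_space_measurable[OF f] by (intro esssup_I) auto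
  then show False using r by simp
qed

lemma bv_norm_eq_0_iff:
  assumes f: "f \<in> bv_space"
  shows "bv_norm f = 0 \<longleftrightarrow> ae_eq unit_lebesgue f (\<lambda>x. 0)"
proof
  assume "bv_norm f = 0"
  then have ess: "ess_norm unit_lebesgue f \<le> ereal 0"
    using ess_norm_le_bv_norm[OF f] by simp
  have "AE x in unit_lebesgue. ereal (cmod (f x)) \<le> ess_norm unit_lebesgue f"
    unfolding ess_norm_def by (rule esssup_AE)
  then show "ae_eq unit_lebesgue f (\<lambda>x. 0)"
    unfolding ae_eq_def
  proof eventually_elim
    case (elim x)
    from order_trans[OF this ess] show ?case by (simp only: ereal_less_eq norm_le_zero_iff)
  qed
next
  assume "ae_eq unit_lebesgue f (\<lambda>x. 0)"
  then have "bv_version f (\<lambda>x. 0) 0 0"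
    using bv_version_const[of 0] by (simp add: bv_version_def)
  then show "bv_norm f = 0"
    using bv_norm_le bv_norm_nonneg[OF f] by force
qed

text \<open>
  Sup norm and variation are lower semicontinuous along pointwise limits. So versions of the
  increments of a rapidly Cauchy subsequence can be summed pointwise, and each remainder inherits
  the geometric bound of its partial sums.
\<close>

lemma bv_space_complete:
  fixes u :: "nat \<Rightarrow> real \<Rightarrow> complex"
  assumes u: "\<And>n. u n \<in> bv_space"
    and cauchy: "\<And>e. e > 0 \<Longrightarrow> \<exists>n0. \<forall>m\<ge>n0. \<forall>n\<ge>n0. bv_norm (\<lambda>x. u m x - u n x) < e"
  shows "\<exists>f\<in>bv_space. (\<lambda>n. bv_norm (\<lambda>x. u n x - f x)) \<longlonglongrightarrow> 0"
proof -
  have "\<forall>k. \<exists>n0. \<forall>m\<ge>n0. \<forall>n\<ge>n0. bv_norm (\<lambda>x. u m x - u n x) < (1/2) ^ k"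
    using cauchy by simp
  then obtain N where N: "\<And>k m n. m \<ge> N k \<Longrightarrow> n \<ge> N k \<Longrightarrow> bv_norm (\<lambda>x. u m x - u n x) < (1/2) ^ k"
    by metis
  define r where "r k = (\<Sum>j\<le>k. N j)" for k
  have r: "N k \<le> r k" "N k \<le> r (Suc k)" for k
  proof -
    show "N k \<le> r k" unfolding r_def by (rule member_le_sum) auto
    then show "N k \<le> r (Suc k)" by (simp add: r_def)
  qed
  have "\<exists>g A V. bv_version (\<lambda>x. u (r (Suc k)) x - u (r k) x) g A V \<and> A + V < (1/2) ^ k" for k
    using bv_norm_less_obtain[OF bv_space_diff[OF u u] N[OF r(2) r(1)]] by metis
  then obtain d A V where d: "\<And>k. bv_version (\<lambda>x. u (r (Suc k)) x - u (r k) x) (d k) (A k) (V k)"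
    and AV: "\<And>k. A k + V k < (1/2) ^ k"
    by metis
  have partial: "bv_version (\<lambda>x. u (r (k + m)) x - u (r k) x) (\<lambda>x. \<Sum>j<m. d (k + j) x)
      (\<Sum>j<m. A (k + j)) (\<Sum>j<m. V (k + j))" for k m
  proof (induction m)
    case 0
    show ?case using bv_version_const[of 0] by simp
  next
    case (Suc m)
    show ?case using bv_version_add[OF Suc d[of "k + m"]] by simp
  qed
  have sums: "(\<Sum>j<m. A (k + j)) \<le> 2 * (1/2) ^ k" "(\<Sum>j<m. V (k + j)) \<le> 2 * (1/2) ^ k" for k m
  proof -
    have "(\<Sum>j<m. A (k + j)) + (\<Sum>j<m. V (k + j)) \<le> (\<Sum>j<m. (1/2) ^ (k + j))"
      unfolding sum.distrib[symmetric] by (intro sum_mono less_imp_le AV)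
    also have "\<dots> = (1/2) ^ k * (\<Sum>j<m. (1/2) ^ j)"
      by (simp add: power_add sum_distrib_left)
    also have "\<dots> = (1/2) ^ k * (2 * (1 - (1/2) ^ m))"
      by (subst sum_gp_strict) simp
    also have "\<dots> \<le> (1/2) ^ k * (2 * 1)"
      by (intro mult_left_mono) simp_all
    finally have "(\<Sum>j<m. A (k + j)) + (\<Sum>j<m. V (k + j)) \<le> 2 * (1/2) ^ k" by simp
    moreover have "0 \<le> (\<Sum>j<m. A (k + j))" "0 \<le> (\<Sum>j<m. V (k + j))"
      using bv_version_nonneg[OF d] by (auto intro: sum_nonneg)
    ultimately show "(\<Sum>j<m. A (k + j)) \<le> 2 * (1/2) ^ k" "(\<Sum>j<m. V (k + j)) \<le> 2 * (1/2) ^ k"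
      by linarith+
  qed
  define R where "R k x = (\<Sum>j. d (k + j) x)" for k x
  have summable: "summable (\<lambda>j. d (k + j) x)" if "x \<in> {0..<1}" for k x
  proof (rule summable_comparison_test')
    show "summable (\<lambda>j. (1/2 :: real) ^ (k + j))"
      by (simp add: power_add summable_mult)
    show "cmod (d (k + j) x) \<le> (1/2) ^ (k + j)" for j
      using d[of "k + j"] that AV[of "k + j"] bv_version_nonneg[OF d[of "k + j"]]
      unfolding bv_version_def by force
  qed
  then have lim: "(\<lambda>m. \<Sum>j<m. d (k + j) x) \<longlonglongrightarrow> R k x" if "x \<in> {0..<1}" for k x
    using that unfolding R_def by (intro summable_LIMSEQ)
  have Rmeas: "R k \<in> borel_measurable unit_lebesgue" for k
  proof (rule borel_measurable_LIMSEQ_metric)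
    show "(\<lambda>x. \<Sum>j<m. d (k + j) x) \<in> borel_measurable unit_lebesgue" for m
      using partial[of k m] by (simp add: bv_version_def)
  qed (use lim in simp)
  have Rbound: "cmod (R k x) \<le> 2 * (1/2) ^ k" if "x \<in> {0..<1}" for k x
  proof (rule LIMSEQ_le_const2[OF tendsto_norm[OF lim[OF that, of k]]], intro exI[of _ 0] allI impI)
    fix m show "cmod (\<Sum>j<m. d (k + j) x) \<le> 2 * (1/2) ^ k"
      using partial[of k m] that sums(1)[of k m] unfolding bv_version_def by force
  qed
  have Rvar: "variation_le (R k) (2 * (1/2) ^ k)" for k
  proof (rule variation_le_pointwise_limit[OF _ lim])
    show "variation_le (\<lambda>x. \<Sum>j<m. d (k + j) x) (2 * (1/2) ^ k)" for m
      using partial[of k m] sums(2)[of k m] variation_le_mono unfolding bv_version_def by blast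
  qed
  define f where "f = (\<lambda>x. u (r 0) x + R 0 x)"
  have "bv_version (R 0) (R 0) (2 * (1/2) ^ 0) (2 * (1/2) ^ 0)"
    using Rmeas Rbound Rvar unfolding bv_version_def ae_eq_def by blast
  then have f: "f \<in> bv_space"
    unfolding f_def using Rmeas by (intro bv_space_add u bv_spaceI)
  have tail: "bv_version (\<lambda>x. f x - u (r k) x) (R k) (2 * (1/2) ^ k) (2 * (1/2) ^ k)" for k
  proof -
    have "AE x in unit_lebesgue. u (r (0 + k)) x - u (r 0) x = (\<Sum>j<k. d (0 + j) x)"
      using partial[of 0 k] by (simp add: bv_version_def ae_eq_def)
    moreover have "AE x in unit_lebesgue. R 0 x = R k x + (\<Sum>j<k. d (0 + j) x)"
    proof (rule AE_I2)
      fix x assume "x \<in> space unit_lebesgue"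
      then show "R 0 x = R k x + (\<Sum>j<k. d (0 + j) x)"
        using suminf_split_initial_segment[OF summable[of x 0], of k]
        by (simp add: R_def add.commute)
    qed
    ultimately have "ae_eq unit_lebesgue (\<lambda>x. f x - u (r k) x) (R k)"
      unfolding ae_eq_def
    proof eventually_elim
      case (elim x)
      show ?case unfolding f_def elim(2) elim(1)[symmetric] by simp
    qed
    then show ?thesis using Rmeas Rbound Rvar by (simp add: bv_version_def)
  qed
  have "(\<lambda>n. bv_norm (\<lambda>x. u n x - f x)) \<longlonglongrightarrow> 0"
  proof (rule LIMSEQ_I)
    fix e :: real assume "e > 0"
    then obtain k where k: "(1/2) ^ k < e / 5"
      using real_arch_pow_inv[of "e / 5" "1/2"] by auto
    have "norm (bv_norm (\<lambda>x. u n x - f x) - 0) < e" if n: "n \<ge> N k" for n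
    proof -
      have "bv_norm (\<lambda>x. u n x - f x) =
          bv_norm (\<lambda>x. (u n x - u (r k) x) + (u (r k) x - f x))" by simp
      also have "\<dots> \<le> bv_norm (\<lambda>x. u n x - u (r k) x) + bv_norm (\<lambda>x. u (r k) x - f x)"
        by (rule bv_norm_add[OF bv_space_diff[OF u u] bv_space_diff[OF u f]])
      also have "bv_norm (\<lambda>x. u (r k) x - f x) = bv_norm (\<lambda>x. f x - u (r k) x)"
        by (rule bv_norm_minus_commute[OF u f])
      also have "\<dots> \<le> 4 * (1/2) ^ k"
        using bv_norm_le[OF tail[of k]] by simp
      also have "bv_norm (\<lambda>x. u n x - u (r k) x) < (1/2) ^ k"
        by (rule N[OF n r(1)])
      finally have "bv_norm (\<lambda>x. u n x - f x) < 5 * (1/2) ^ k" by simp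
      then show ?thesis using k bv_norm_nonneg[OF bv_space_diff[OF u f]] by simp
    qed
    then show "\<exists>n0. \<forall>n\<ge>n0. norm (bv_norm (\<lambda>x. u n x - f x) - 0) < e" by blast
  qed
  then show ?thesis using f by blast
qed

lemma function_banach_algebra_bv: "function_banach_algebra unit_lebesgue bv_space bv_norm"
  unfolding function_banach_algebra_def
proof (intro conjI ballI allI impI)
  fix f g assume fg: "f \<in> bv_space" "g \<in> borel_measurable unit_lebesgue" "ae_eq unit_lebesgue f g"
  show "g \<in> bv_space"
    using fg bv_version_cong[OF fg(3)] bv_spaceI by (meson bv_spaceE)
  show "bv_norm g = bv_norm f" by (simp add: bv_norm_def bv_version_cong[OF fg(3)])
next
  fix u :: "nat \<Rightarrow> real \<Rightarrow> complex"
  assume "range u \<subseteq> bv_space" "\<forall>e>0. \<exists>n0. \<forall>m\<ge>n0. \<forall>n\<ge>n0. bv_norm (\<lambda>x. u m x - u n x) < e"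
  then show "\<exists>f\<in>bv_space. (\<lambda>n. bv_norm (\<lambda>x. u n x - f x)) \<longlonglongrightarrow> 0"
    by (intro bv_space_complete) auto
qed (auto intro: bv_space_measurable bv_space_const bv_space_add bv_space_cmult bv_space_mult
    bv_norm_nonneg bv_norm_cmult bv_norm_add bv_norm_mult simp: bv_norm_eq_0_iff)

section \<open>The transfer operator of the doubling map\<close>

text \<open>
  The doubling map has the two inverse branches \<open>x / 2\<close> and \<open>(x + 1) / 2\<close>, each
  of slope \<open>1/2\<close>.
\<close>

definition doubling_transfer :: "(real \<Rightarrow> complex) \<Rightarrow> real \<Rightarrow> complex" where
  "doubling_transfer g x = (g (x / 2) + g ((x + 1) / 2)) / 2"

text \<open>
  The images of a partition under the two branches lie in \<open>[0,1/2)\<close> and \<open>[1/2,1)\<close>;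
  listed one after the other they form a single partition. So the two variations add up to at
  most \<open>V\<close>, and the weight \<open>1/2\<close> remains as a contraction factor.
\<close>

lemma variation_le_doubling_transfer:
  assumes "variation_le g V"
  shows "variation_le (doubling_transfer g) (V / 2)"
proof (rule variation_leI)
  fix n and t :: "nat \<Rightarrow> real"
  assume pts: "ordered_points n t"
  then have t: "i \<le> n \<Longrightarrow> t i \<in> {0..<1}" "i < n \<Longrightarrow> t i \<le> t (Suc i)" for i
    by (simp_all add: ordered_points_def)
  define s where "s i = (if i \<le> n then t i / 2 else (t (i - Suc n) + 1) / 2)" for i
  define d where "d i = cmod (g (s (Suc i)) - g (s i))" for i
  have "ordered_points (n + Suc n) s"
    unfolding ordered_points_def
  proof (intro conjI allI impI)
    fix i assume i: "i \<le> n + Suc n"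
    show "s i \<in> {0..<1}"
      using t(1)[of i] t(1)[of "i - Suc n"] i by (auto simp: s_def)
  next
    fix i assume i: "i < n + Suc n"
    consider "i < n" | "i = n" | "i > n" by linarith
    then show "s i \<le> s (Suc i)"
    proof cases
      case 1
      then show ?thesis using t(2)[of i] by (simp add: s_def)
    next
      case 2
      then show ?thesis using t(1)[of n] t(1)[of 0] by (simp add: s_def)
    next
      case 3
      then show ?thesis using t(2)[of "i - Suc n"] i by (simp add: s_def Suc_diff_Suc)
    qed
  qed
  then have "(\<Sum>i<n + Suc n. d i) \<le> V"
    unfolding d_def by (rule variation_leD[OF assms])
  moreover have "(\<Sum>i<n + Suc n. d i) = (\<Sum>i<n. d i) + d n + (\<Sum>i<n. d (Suc n + i))"
  proof -
    have "(\<Sum>i<Suc n + m. d i) = (\<Sum>i<Suc n. d i) + (\<Sum>i<m. d (Suc n + i))" for m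
      by (induction m) auto
    from this[of n] show ?thesis by (simp add: add.commute)
  qed
  moreover have "d n \<ge> 0" by (simp add: d_def)
  ultimately have *: "(\<Sum>i<n. d i) + (\<Sum>i<n. d (Suc n + i)) \<le> V" by simp
  have "(\<Sum>i<n. cmod (doubling_transfer g (t (Suc i)) - doubling_transfer g (t i)))
      \<le> (\<Sum>i<n. (d i + d (Suc n + i)) / 2)"
  proof (intro sum_mono)
    fix i assume i: "i \<in> {..<n}"
    have "doubling_transfer g (t (Suc i)) - doubling_transfer g (t i) =
        ((g (s (Suc i)) - g (s i)) + (g (s (Suc (Suc n + i))) - g (s (Suc n + i)))) / 2"
      using i by (simp add: doubling_transfer_def s_def field_simps)
    then have "cmod (doubling_transfer g (t (Suc i)) - doubling_transfer g (t i)) =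
        cmod ((g (s (Suc i)) - g (s i)) + (g (s (Suc (Suc n + i))) - g (s (Suc n + i)))) / 2"
      by (simp only: norm_divide norm_numeral)
    also have "\<dots> \<le> (d i + d (Suc n + i)) / 2"
      unfolding d_def by (intro divide_right_mono norm_triangle_ineq) simp
    finally show "cmod (doubling_transfer g (t (Suc i)) - doubling_transfer g (t i)) \<le> (d i + d (Suc n + i)) / 2" .
  qed
  also have "\<dots> = ((\<Sum>i<n. d i) + (\<Sum>i<n. d (Suc n + i))) / 2"
    by (simp add: sum.distrib flip: sum_divide_distrib)
  finally show "(\<Sum>i<n. cmod (doubling_transfer g (t (Suc i)) - doubling_transfer g (t i))) \<le> V / 2"
    using * by simp
qed

lemma measure_unit_lebesgue_space [simp]: "measure unit_lebesgue {0..<1} = 1"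
  using U.prob_space by simp

lemma doubling_map_eq:
  assumes "x \<in> {0..<1}"
  shows "doubling_map x = (if x < 1/2 then 2 * x else 2 * x - 1)"
proof (cases "x < 1/2")
  case True
  then show ?thesis using assms by (simp add: doubling_map_def frac_eq)
next
  case False
  then have "\<lfloor>2 * x\<rfloor> = 1" using assms by (intro floor_unique) auto
  then show ?thesis using False by (simp add: doubling_map_def frac_def)
qed

lemma doubling_map_in: "doubling_map x \<in> {0..<1}"
  by (simp add: doubling_map_def frac_lt_1)

lemma unit_lebesgue_self_map:
  assumes "f \<in> borel_measurable borel" "\<And>x. x \<in> {0..<1} \<Longrightarrow> f x \<in> {0..<1}"
  shows "f \<in> measurable unit_lebesgue unit_lebesgue"
  unfolding unit_lebesgue_def using assms by (intro measurable_restrict_space3) auto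

lemma doubling_map_measurable [measurable]: "doubling_map \<in> measurable unit_lebesgue unit_lebesgue"
proof (rule unit_lebesgue_self_map[OF _ doubling_map_in])
  show "doubling_map \<in> borel_measurable borel"
    unfolding doubling_map_def frac_def by measurable
qed

lemma doubling_transfer_measurable [measurable]:
  assumes [measurable]: "f \<in> borel_measurable unit_lebesgue"
  shows "doubling_transfer f \<in> borel_measurable unit_lebesgue"
proof -
  have [measurable]: "(\<lambda>x::real. x / 2) \<in> measurable unit_lebesgue unit_lebesgue"
    "(\<lambda>x::real. (x + 1) / 2) \<in> measurable unit_lebesgue unit_lebesgue"
    by (auto intro!: unit_lebesgue_self_map)
  show ?thesis unfolding doubling_transfer_def by measurable
qed

lemma doubling_transfer_bound:
  assumes "\<And>x. x \<in> {0..<1} \<Longrightarrow> cmod (f x) \<le> A" "x \<in> {0..<1}"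
  shows "cmod (doubling_transfer f x) \<le> A"
proof -
  have "cmod (f (x / 2) + f ((x + 1) / 2)) \<le> A + A"
    using assms by (intro norm_triangle_mono assms(1)) auto
  then show ?thesis by (simp add: doubling_transfer_def norm_divide)
qed

lemma ess_norm_less_infinityE:
  assumes "ess_norm M g < \<infinity>"
  obtains B where "AE x in M. cmod (g x) \<le> B"
proof (cases "ess_norm M g")
  case (real B)
  have "AE x in M. ereal (cmod (g x)) \<le> ess_norm M g"
    unfolding ess_norm_def by (rule esssup_AE)
  then show ?thesis using real that[of B] by simp
next
  case PInf
  then show ?thesis using assms by simp
next
  case MInf
  have "AE x in M. ereal (cmod (g x)) \<le> ess_norm M g"
    unfolding ess_norm_def by (rule esssup_AE)
  then have "AE x in M. cmod (g x) \<le> 0" using MInf by (auto elim: eventually_mono)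
  then show ?thesis by (rule that)
qed

lemma ess_norm_less_infinityI:
  assumes "g \<in> borel_measurable M" "\<And>x. x \<in> space M \<Longrightarrow> cmod (g x) \<le> B"
  shows "ess_norm M g < \<infinity>"
proof -
  have "ess_norm M g \<le> ereal B"
    unfolding ess_norm_def using assms by (intro esssup_I AE_I2) auto
  then show ?thesis by (rule order.strict_trans1) simp
qed

text \<open>
  The substitutions \<open>y = 2 x\<close> and \<open>y = 2 x - 1\<close> on the two halves of the interval.
\<close>

lemma integral_doubling_transfer:
  assumes f [measurable]: "f \<in> borel_measurable unit_lebesgue"
    and A: "\<And>x. x \<in> {0..<1} \<Longrightarrow> cmod (f x) \<le> A"
    and g [measurable]: "g \<in> borel_measurable unit_lebesgue" and ess: "ess_norm unit_lebesgue g < \<infinity>"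
  shows "(LINT x|unit_lebesgue. doubling_transfer f x * g x) =
    (LINT x|unit_lebesgue. f x * g (doubling_map x))"
proof -
  obtain B where B: "AE x in unit_lebesgue. cmod (g x) \<le> B"
    using ess_norm_less_infinityE[OF ess] .
  have A0: "0 \<le> A" using A[of 0] norm_ge_zero[of "f 0"] by (simp del: norm_ge_zero)
  have maps [measurable]: "(\<lambda>x::real. x / 2) \<in> measurable unit_lebesgue unit_lebesgue"
    "(\<lambda>x::real. (x + 1) / 2) \<in> measurable unit_lebesgue unit_lebesgue"
    by (auto intro!: unit_lebesgue_self_map)
  have bounded: "AE x in unit_lebesgue. cmod (f (\<phi> x) * g x) \<le> A * B"
    if "\<And>x. x \<in> {0..<1} \<Longrightarrow> \<phi> x \<in> {0..<1}" for \<phi>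
    using B
  proof (rule AE_mp, intro AE_I2 impI)
    fix x assume "x \<in> space unit_lebesgue" "cmod (g x) \<le> B"
    then show "cmod (f (\<phi> x) * g x) \<le> A * B"
      unfolding norm_mult using A that A0 by (intro mult_mono) auto
  qed
  have int: "integrable unit_lebesgue (\<lambda>x. f (x / 2) * g x)"
    "integrable unit_lebesgue (\<lambda>x. f ((x + 1) / 2) * g x)"
    by (rule U.integrable_const_bound[OF bounded], auto)+
  define u where "u x = indicator {0..<1::real} x *\<^sub>R (f (x / 2) * g x)" for x
  define v where "v x = indicator {0..<1::real} x *\<^sub>R (f ((x + 1) / 2) * g x)" for x
  have u: "integrable lborel u" and v: "integrable lborel v"
    using int by (simp_all add: unit_lebesgue_def integrable_restrict_space u_def[abs_def] v_def[abs_def])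
  have "(LINT x|unit_lebesgue. doubling_transfer f x * g x) =
      (LINT x|unit_lebesgue. (f (x / 2) * g x + f ((x + 1) / 2) * g x) / 2)"
    by (simp add: doubling_transfer_def field_simps)
  also have "\<dots> = ((LINT x|unit_lebesgue. f (x / 2) * g x) + (LINT x|unit_lebesgue. f ((x + 1) / 2) * g x)) / 2"
    using int by simp
  also have "\<dots> = ((LINT x|lborel. u x) + (LINT x|lborel. v x)) / 2"
    by (simp add: unit_lebesgue_def integral_restrict_space u_def v_def)
  also have "\<dots> = (LINT x|lborel. u (0 + 2 * x)) + (LINT x|lborel. v (-1 + 2 * x))"
    by (subst lborel_integral_real_affine[of 2 u 0], simp, subst lborel_integral_real_affine[of 2 v "-1"])
      (simp_all add: scaleR_conv_of_real add_divide_distrib)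
  also have "\<dots> = (LINT x|lborel. u (0 + 2 * x) + v (-1 + 2 * x))"
    using u v by (intro Bochner_Integration.integral_add[symmetric] lborel_integrable_real_affine) auto
  also have "\<dots> = (LINT x|lborel. indicator {0..<1} x *\<^sub>R (f x * g (doubling_map x)))"
  proof (intro Bochner_Integration.integral_cong refl)
    fix x :: real
    consider "x < 0" | "0 \<le> x" "x < 1/2" | "1/2 \<le> x" "x < 1" | "1 \<le> x" by linarith
    then show "u (0 + 2 * x) + v (-1 + 2 * x) = indicator {0..<1} x *\<^sub>R (f x * g (doubling_map x))"
      by cases (simp_all add: u_def v_def doubling_map_eq)
  qed
  also have "\<dots> = (LINT x|unit_lebesgue. f x * g (doubling_map x))"
    by (simp add: unit_lebesgue_def integral_restrict_space)
  finally show ?thesis .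
qed

text \<open>
  Testing against \<open>cnj d / |d|\<close> with \<open>d = h - k\<close>, a function of modulus at most \<open>1\<close>, produces the
  integral of \<open>|d|\<close>.
\<close>

lemma AE_eq_if_integrals_eq:
  fixes h k :: "'a \<Rightarrow> complex"
  assumes h: "integrable M h" and k: "integrable M k"
    and eq: "\<And>g. g \<in> borel_measurable M \<Longrightarrow> ess_norm M g < \<infinity> \<Longrightarrow>
      (LINT x|M. h x * g x) = (LINT x|M. k x * g x)"
  shows "AE x in M. h x = k x"
proof -
  have [measurable]: "h \<in> borel_measurable M" "k \<in> borel_measurable M"
    using h k by auto
  define d where "d x = h x - k x" for x
  define g where "g x = cnj (d x) / of_real (cmod (d x))" for x
  have d [measurable]: "d \<in> borel_measurable M" unfolding d_def by measurable
  have cnj [measurable]: "cnj \<in> borel_measurable borel"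
    by (intro borel_measurable_continuous_onI continuous_intros)
  have g [measurable]: "g \<in> borel_measurable M" unfolding g_def by measurable
  have g1: "cmod (g x) \<le> 1" for x by (simp add: g_def norm_divide)
  have int: "integrable M (\<lambda>x. h x * g x)" "integrable M (\<lambda>x. k x * g x)"
    by (rule Bochner_Integration.integrable_bound[OF h], use g1 in \<open>auto simp: norm_mult mult_left_le\<close>)
      (rule Bochner_Integration.integrable_bound[OF k], use g1 in \<open>auto simp: norm_mult mult_left_le\<close>)
  have "d x * g x = of_real (cmod (d x))" for x
    using complex_norm_square[of "d x"]
    by (cases "d x = 0") (simp_all add: g_def power2_eq_square nonzero_divide_eq_eq)
  then have "(LINT x|M. complex_of_real (cmod (d x))) = (LINT x|M. h x * g x - k x * g x)"
    by (metis (no_types, lifting) d_def left_diff_distrib)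
  also have "\<dots> = 0"
    using int eq[OF g ess_norm_less_infinityI[OF g g1]] by simp
  finally have "(LINT x|M. cmod (d x)) = 0" by simp
  moreover have "integrable M d" unfolding d_def using h k by simp
  ultimately have "AE x in M. d x = 0" by (subst (asm) integral_nonneg_eq_0_iff_AE) simp_all
  then show ?thesis by (simp add: d_def)
qed

lemma bv_version_integrable:
  assumes "bv_version f g A V"
  shows "integrable unit_lebesgue g"
  using assms unfolding bv_version_def by (intro U.integrable_const_bound[of _ A] AE_I2) auto

lemma bv_version_integral_eq:
  assumes "f \<in> bv_space" "bv_version f g A V"
  shows "(LINT x|unit_lebesgue. f x) = (LINT x|unit_lebesgue. g x)"
  using assms bv_space_measurable[OF assms(1)] unfolding bv_version_def ae_eq_def
  by (intro integral_cong_AE) auto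

lemma bv_version_integral_le:
  assumes "f \<in> bv_space" "bv_version f g A V"
  shows "cmod (LINT x|unit_lebesgue. f x) \<le> A"
proof -
  have "cmod (LINT x|unit_lebesgue. g x) \<le> (LINT x|unit_lebesgue. A)"
  proof (rule Bochner_Integration.integral_norm_bound_integral)
    show "integrable unit_lebesgue g" by (rule bv_version_integrable[OF assms(2)])
  qed (use assms(2) in \<open>auto simp: bv_version_def\<close>)
  then show ?thesis using bv_version_integral_eq[OF assms] by (simp add: U.prob_space)
qed

lemma dist_mean_le_variation:
  assumes "integrable unit_lebesgue g" "variation_le g V" "x \<in> {0..<1}"
  shows "cmod (g x - (LINT y|unit_lebesgue. g y)) \<le> V"
proof -
  have "g x - (LINT y|unit_lebesgue. g y) = (LINT y|unit_lebesgue. g x - g y)"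
    using assms(1) by (simp add: U.prob_space)
  also have "cmod \<dots> \<le> (LINT y|unit_lebesgue. V)"
    using assms by (intro Bochner_Integration.integral_norm_bound_integral variation_le_dist) auto
  finally show ?thesis by (simp add: U.prob_space)
qed

text \<open>
  The transfer operator is an arbitrary choice among the functions that are dual to composition with
  the doubling map. One of them is the explicit \<open>doubling_transfer g\<close>, and any two agree almost
  everywhere.
\<close>

lemma transfer_op_version:
  assumes f: "f \<in> bv_space" and g: "bv_version f g A V"
  shows "bv_version (transfer_op unit_lebesgue doubling_map f) (doubling_transfer g) A (V / 2)"
    and "transfer_op unit_lebesgue doubling_map f \<in> bv_space"
proof -
  let ?h = "transfer_op unit_lebesgue doubling_map f"
  let ?Q = "\<lambda>h. integrable unit_lebesgue h \<and>
    (\<forall>k\<in>borel_measurable unit_lebesgue. ess_norm unit_lebesgue k < \<infinity> \<longrightarrow>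
      (LINT x|unit_lebesgue. h x * k x) = (LINT x|unit_lebesgue. f x * k (doubling_map x)))"
  have [measurable]: "f \<in> borel_measurable unit_lebesgue" "g \<in> borel_measurable unit_lebesgue"
    using bv_space_measurable[OF f] g by (auto simp: bv_version_def)
  have bound: "\<And>x. x \<in> {0..<1} \<Longrightarrow> cmod (g x) \<le> A" using g by (simp add: bv_version_def)
  have L: "bv_version (doubling_transfer g) (doubling_transfer g) A (V / 2)"
    using g doubling_transfer_bound[OF bound] variation_le_doubling_transfer
    by (simp add: bv_version_def ae_eq_def)
  have "?Q (doubling_transfer g)"
  proof (intro conjI ballI impI)
    show "integrable unit_lebesgue (doubling_transfer g)"
      by (rule bv_version_integrable[OF L])
    fix k assume k [measurable]: "k \<in> borel_measurable unit_lebesgue" and "ess_norm unit_lebesgue k < \<infinity>"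
    then have "(LINT x|unit_lebesgue. doubling_transfer g x * k x) = (LINT x|unit_lebesgue. g x * k (doubling_map x))"
      using bound by (intro integral_doubling_transfer) auto
    also have "\<dots> = (LINT x|unit_lebesgue. f x * k (doubling_map x))"
      using g by (intro integral_cong_AE) (auto simp: bv_version_def ae_eq_def)
    finally show "(LINT x|unit_lebesgue. doubling_transfer g x * k x) = \<dots>" .
  qed
  moreover from this have "?Q ?h"
    unfolding transfer_op_def by (rule someI[of ?Q])
  ultimately have "ae_eq unit_lebesgue ?h (doubling_transfer g)"
    unfolding ae_eq_def by (intro AE_eq_if_integrals_eq) auto
  then show version: "bv_version ?h (doubling_transfer g) A (V / 2)"
    using L by (simp add: bv_version_def)
  show "?h \<in> bv_space"
    using \<open>?Q ?h\<close> by (intro bv_spaceI[OF _ version]) auto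
qed

abbreviation transfer :: "(real \<Rightarrow> complex) \<Rightarrow> real \<Rightarrow> complex" where
  "transfer \<equiv> transfer_op unit_lebesgue doubling_map"

abbreviation mean :: "(real \<Rightarrow> complex) \<Rightarrow> complex" where
  "mean f \<equiv> LINT x|unit_lebesgue. f x"

lemma bv_space_integrable:
  assumes "f \<in> bv_space"
  shows "integrable unit_lebesgue f"
proof -
  obtain g A V where g: "bv_version f g A V" using assms by (rule bv_spaceE)
  have "integrable unit_lebesgue f \<longleftrightarrow> integrable unit_lebesgue g"
    using g bv_space_measurable[OF assms] unfolding bv_version_def ae_eq_def
    by (intro integrable_cong_AE) auto
  then show ?thesis using bv_version_integrable[OF g] by simp
qed

lemma transfer_ae_eq:
  assumes "f \<in> bv_space" "bv_version f g A V"
  shows "AE x in unit_lebesgue. transfer f x = doubling_transfer g x"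
  using transfer_op_version(1)[OF assms] by (simp add: bv_version_def ae_eq_def)

lemma bounded_linear_op_transfer: "bounded_linear_op unit_lebesgue bv_space bv_norm transfer"
  unfolding bounded_linear_op_def
proof (intro conjI ballI allI exI[of _ 1])
  fix f assume f: "f \<in> bv_space"
  show "transfer f \<in> bv_space"
    using f transfer_op_version(2) by (blast elim: bv_spaceE)
  show "bv_norm (transfer f) \<le> 1 * bv_norm f"
  proof (rule le_bv_normI[OF f])
    fix g A V assume g: "bv_version f g A V"
    show "bv_norm (transfer f) \<le> 1 * (A + V)"
      using bv_norm_le[OF transfer_op_version(1)[OF f g]] bv_version_nonneg[OF g] by simp
  qed simp
next
  fix f f' assume f: "f \<in> bv_space" "f' \<in> bv_space"
  obtain g A V where g: "bv_version f g A V" using f(1) by (rule bv_spaceE)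
  obtain g' A' V' where g': "bv_version f' g' A' V'" using f(2) by (rule bv_spaceE)
  show "ae_eq unit_lebesgue (transfer (\<lambda>x. f x + f' x)) (\<lambda>x. transfer f x + transfer f' x)"
    using transfer_ae_eq[OF bv_space_add[OF f] bv_version_add[OF g g']]
      transfer_ae_eq[OF f(1) g] transfer_ae_eq[OF f(2) g'] unfolding ae_eq_def
    by eventually_elim (simp add: doubling_transfer_def add_divide_distrib distrib_left)
next
  fix c f assume f: "f \<in> bv_space"
  obtain g A V where g: "bv_version f g A V" using f by (rule bv_spaceE)
  show "ae_eq unit_lebesgue (transfer (\<lambda>x. c * f x)) (\<lambda>x. c * transfer f x)"
    using transfer_ae_eq[OF bv_space_cmult[OF f] bv_version_cmult[OF g, of c]] transfer_ae_eq[OF f g]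
    unfolding ae_eq_def
    by eventually_elim (simp add: doubling_transfer_def add_divide_distrib distrib_left)
qed simp

lemma transfer_const: "ae_eq unit_lebesgue (transfer (\<lambda>x. c)) (\<lambda>x. c)"
  using transfer_ae_eq[OF bv_space_const bv_version_const[of c]]
  by (simp add: ae_eq_def doubling_transfer_def)

lemma mean_const [simp]: "mean (\<lambda>x. c) = c"
  by (simp add: U.prob_space)

lemma mean_transfer:
  assumes f: "f \<in> bv_space"
  shows "mean (transfer f) = mean f"
proof -
  obtain g A V where g: "bv_version f g A V" using f by (rule bv_spaceE)
  have "mean (transfer f) = mean (\<lambda>x. doubling_transfer g x * 1)"
    using bv_version_integral_eq[OF transfer_op_version(2,1)[OF f g]] by simp
  also have "\<dots> = mean (\<lambda>x. g x * 1)"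
    using g by (intro integral_doubling_transfer ess_norm_less_infinityI[of _ _ 1])
      (auto simp: bv_version_def)
  also have "\<dots> = mean f"
    using bv_version_integral_eq[OF f g] by simp
  finally show ?thesis .
qed

section \<open>Spectral gap\<close>

text \<open>
  After subtracting the mean, the sup norm is controlled by the variation, and the transfer
  operator halves the latter. So one step leaves at most \<open>V / 2\<close> of each part of the norm.
\<close>

lemma transfer_minus_mean_version:
  assumes f: "f \<in> bv_space" and g: "bv_version f g A V"
  shows "bv_version (\<lambda>x. transfer f x - mean f) (\<lambda>x. doubling_transfer g x - mean f) (V / 2) (V / 2)"
    and "(\<lambda>x. transfer f x - mean f) \<in> bv_space"
proof -
  note T = transfer_op_version(1)[OF f g] and T_in = transfer_op_version(2)[OF f g]
  have "mean (doubling_transfer g) = mean f"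
    using bv_version_integral_eq[OF T_in T] mean_transfer[OF f] by simp
  moreover have "variation_le (doubling_transfer g) (V / 2)"
    using T unfolding bv_version_def by blast
  ultimately have "cmod (doubling_transfer g x - mean f) \<le> V / 2" if "x \<in> {0..<1}" for x
    using dist_mean_le_variation[OF bv_version_integrable[OF T] _ that] by metis
  moreover have "variation_le (\<lambda>x. doubling_transfer g x + (- mean f)) (V / 2 + 0)"
    using T by (intro variation_le_add variation_le_const) (simp add: bv_version_def)
  ultimately show "bv_version (\<lambda>x. transfer f x - mean f) (\<lambda>x. doubling_transfer g x - mean f) (V / 2) (V / 2)"
    using T by (auto simp: bv_version_def ae_eq_def elim: eventually_mono)
  show "(\<lambda>x. transfer f x - mean f) \<in> bv_space"
    by (rule bv_space_diff[OF T_in bv_space_const])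
qed

text \<open>
  The supremum bound \<open>A\<close> of \<open>f\<close> itself appears only for \<open>k = 0\<close>; after one step the variation
  controls both quantities.
\<close>

lemma transfer_minus_mean_funpow_version:
  assumes f: "f \<in> bv_space" and g: "bv_version f g A V"
  shows "((\<lambda>f x. transfer f x - mean f) ^^ k) f \<in> bv_space \<and>
    (\<exists>h. bv_version (((\<lambda>f x. transfer f x - mean f) ^^ k) f) h
       (if k = 0 then A else V * (1/2) ^ k) (V * (1/2) ^ k))"
proof (induction k)
  case 0
  then show ?case using f g by auto
next
  case (Suc k)
  then obtain h where "bv_version (((\<lambda>f x. transfer f x - mean f) ^^ k) f) h
       (if k = 0 then A else V * (1/2) ^ k) (V * (1/2) ^ k)" by blast
  from transfer_minus_mean_version[OF conjunct1[OF Suc] this] show ?case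
    by (auto simp: field_simps)
qed

lemma bv_norm_transfer_minus_mean_funpow:
  assumes f: "f \<in> bv_space"
  shows "bv_norm (((\<lambda>f x. transfer f x - mean f) ^^ k) f) \<le> 2 * (1/2) ^ k * bv_norm f"
proof (rule le_bv_normI[OF f])
  fix g A V assume g: "bv_version f g A V"
  obtain h where h: "bv_version (((\<lambda>f x. transfer f x - mean f) ^^ k) f) h
       (if k = 0 then A else V * (1/2) ^ k) (V * (1/2) ^ k)"
    using transfer_minus_mean_funpow_version[OF f g] by blast
  show "bv_norm (((\<lambda>f x. transfer f x - mean f) ^^ k) f) \<le> 2 * (1/2) ^ k * (A + V)"
  proof (cases "k = 0")
    case True
    then show ?thesis using bv_norm_le[OF h] bv_version_nonneg[OF g] by simp
  next
    case False
    then have "bv_norm (((\<lambda>f x. transfer f x - mean f) ^^ k) f) \<le> 2 * (1/2) ^ k * V"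
      using bv_norm_le[OF h] by (simp add: mult_ac)
    also have "\<dots> \<le> 2 * (1/2) ^ k * (A + V)"
      using bv_version_nonneg[OF g] by (intro mult_left_mono) auto
    finally show ?thesis .
  qed
qed simp

lemma bounded_linear_op_mean: "bounded_linear_op unit_lebesgue bv_space bv_norm (\<lambda>f x. mean f)"
  unfolding bounded_linear_op_def
proof (intro conjI ballI allI exI[of _ 1])
  fix f assume f: "f \<in> bv_space"
  show "bv_norm (\<lambda>x. mean f) \<le> 1 * bv_norm f"
  proof (rule le_bv_normI[OF f])
    fix g A V assume g: "bv_version f g A V"
    show "bv_norm (\<lambda>x. mean f) \<le> 1 * (A + V)"
      using bv_norm_le[OF bv_version_const[of "mean f"]] bv_version_integral_le[OF f g]
        bv_version_nonneg[OF g] by simp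
  qed simp
qed (auto simp: ae_eq_def bv_space_integrable intro: bv_space_const)

lemma bounded_linear_op_transfer_minus_mean:
  "bounded_linear_op unit_lebesgue bv_space bv_norm (\<lambda>f x. transfer f x - mean f)"
  unfolding bounded_linear_op_def
proof (intro conjI ballI allI exI[of _ 1])
  fix f assume f: "f \<in> bv_space"
  show "(\<lambda>x. transfer f x - mean f) \<in> bv_space"
    using f transfer_minus_mean_version(2) by (blast elim: bv_spaceE)
  show "bv_norm (\<lambda>x. transfer f x - mean f) \<le> 1 * bv_norm f"
    using bv_norm_transfer_minus_mean_funpow[OF f, of 1] by simp
next
  fix f g assume f: "f \<in> bv_space" "g \<in> bv_space"
  have "ae_eq unit_lebesgue (transfer (\<lambda>x. f x + g x)) (\<lambda>x. transfer f x + transfer g x)"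
    by (rule op_add[OF bounded_linear_op_transfer f])
  then show "ae_eq unit_lebesgue (\<lambda>x. transfer (\<lambda>x. f x + g x) x - mean (\<lambda>x. f x + g x))
      (\<lambda>x. transfer f x - mean f + (transfer g x - mean g))"
    unfolding ae_eq_def by eventually_elim (use f in \<open>simp add: bv_space_integrable\<close>)
next
  fix c f assume f: "f \<in> bv_space"
  have "ae_eq unit_lebesgue (transfer (\<lambda>x. c * f x)) (\<lambda>x. c * transfer f x)"
    by (rule op_cmult[OF bounded_linear_op_transfer f])
  then show "ae_eq unit_lebesgue (\<lambda>x. transfer (\<lambda>x. c * f x) x - mean (\<lambda>x. c * f x))
      (\<lambda>x. c * (transfer f x - mean f))"
    unfolding ae_eq_def by eventually_elim (simp add: right_diff_distrib)
qed simp

text \<open>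
  The projection is the mean, with eigenvalue \<open>1\<close> on the constants. It annihilates the remainder
  \<open>f \<mapsto> transfer f - mean f\<close> from both sides, because the transfer operator preserves means and
  fixes constants.
\<close>

lemma spectral_gap_transfer: "spectral_gap unit_lebesgue bv_space bv_norm transfer"
proof -
  have "one_dim_image unit_lebesgue bv_space (\<lambda>f x. mean f)"
    unfolding one_dim_image_def
  proof (intro bexI conjI ballI)
    show "\<not> ae_eq unit_lebesgue (\<lambda>x. 1) (\<lambda>x. 0)" by (simp add: ae_eq_def U.AE_False)
    show "ae_eq unit_lebesgue (\<lambda>x. mean (\<lambda>x. 1)) (\<lambda>x. 1)" by (simp add: ae_eq_def)
    show "\<exists>c. ae_eq unit_lebesgue (\<lambda>x. mean f) (\<lambda>x. c * 1)" for f by (auto simp: ae_eq_def)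
  qed (rule bv_space_const)+
  moreover have "op_spectral_radius unit_lebesgue bv_space bv_norm (\<lambda>f x. transfer f x - mean f) < ennreal (cmod 1)"
  proof (rule order.strict_trans1)
    show "op_spectral_radius unit_lebesgue bv_space bv_norm (\<lambda>f x. transfer f x - mean f) \<le> ennreal (1/2)"
      by (rule op_spectral_radius_le_decay_rate[OF function_banach_algebra_bv
            bounded_linear_op_transfer_minus_mean _ _ bv_norm_transfer_minus_mean_funpow]) auto
    show "ennreal (1/2) < ennreal (cmod 1)" by (simp only: norm_one, rule ennreal_lessI) simp_all
  qed
  moreover have "mean (\<lambda>x. transfer f x - mean f) = 0" if f: "f \<in> bv_space" for f
    using mean_transfer[OF f] bv_space_integrable[OF op_in[OF bounded_linear_op_transfer f]]
    by (simp add: U.prob_space)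
  moreover have "ae_eq unit_lebesgue (\<lambda>x. transfer (\<lambda>x. c) x - mean (\<lambda>x. c)) (\<lambda>x. 0)" for c
    using transfer_const[of c] by (simp add: ae_eq_def)
  ultimately show ?thesis
    unfolding spectral_gap_def
    by (intro conjI exI[of _ 1] exI[of _ "\<lambda>f x. mean f"] exI[of _ "\<lambda>f x. transfer f x - mean f"]
        bounded_linear_op_transfer bounded_linear_op_mean bounded_linear_op_transfer_minus_mean ballI)
      (auto simp: ae_eq_def)
qed

section \<open>Decay of correlations and mixing\<close>

lemma doubling_transfer_funpow:
  assumes f: "f \<in> borel_measurable unit_lebesgue" "\<And>x. x \<in> {0..<1} \<Longrightarrow> cmod (f x) \<le> A"
    and V: "variation_le f V"
  shows "(doubling_transfer ^^ n) f \<in> borel_measurable unit_lebesgue \<and>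
    (\<forall>x\<in>{0..<1}. cmod ((doubling_transfer ^^ n) f x) \<le> A) \<and>
    variation_le ((doubling_transfer ^^ n) f) (V * (1/2) ^ n)"
proof (induction n)
  case 0
  then show ?case using assms by simp
next
  case (Suc n)
  then have "variation_le (doubling_transfer ((doubling_transfer ^^ n) f)) (V * (1/2) ^ n / 2)"
    by (intro variation_le_doubling_transfer) simp
  then show ?case
    using Suc by (auto intro!: doubling_transfer_measurable doubling_transfer_bound)
qed

lemma doubling_map_funpow_measurable [measurable]:
  "(doubling_map ^^ n) \<in> measurable unit_lebesgue unit_lebesgue"
  by (rule measurable_compose_n) measurable

lemma integral_doubling_transfer_funpow:
  assumes f: "f \<in> borel_measurable unit_lebesgue" "\<And>x. x \<in> {0..<1} \<Longrightarrow> cmod (f x) \<le> A"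
    and V: "variation_le f V"
    and g: "g \<in> borel_measurable unit_lebesgue" "\<And>x. cmod (g x) \<le> B"
  shows "mean (\<lambda>x. (doubling_transfer ^^ n) f x * g x) = mean (\<lambda>x. f x * g ((doubling_map ^^ n) x))"
  using g
proof (induction n arbitrary: g)
  case (Suc n)
  have [measurable]: "g \<in> borel_measurable unit_lebesgue" by (rule Suc.prems)
  have "mean (\<lambda>x. (doubling_transfer ^^ Suc n) f x * g x) =
      mean (\<lambda>x. (doubling_transfer ^^ n) f x * g (doubling_map x))"
    using doubling_transfer_funpow[OF f V, of n] Suc.prems
    by (simp, intro integral_doubling_transfer[of _ A] ess_norm_less_infinityI[of _ _ B]) auto
  also have "\<dots> = mean (\<lambda>x. f x * g (doubling_map ((doubling_map ^^ n) x)))"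
    by (rule Suc.IH) (use Suc.prems in auto)
  finally show ?case by simp
qed simp

lemma integral_indicator_complex:
  assumes "A \<in> sets unit_lebesgue"
  shows "mean (indicator A) = complex_of_real (measure unit_lebesgue A)"
proof -
  have "mean (indicator A) = mean (\<lambda>x. complex_of_real (indicator A x))"
    by (simp add: of_real_indicator)
  also have "\<dots> = complex_of_real (LINT x|unit_lebesgue. indicator A x)"
    by (rule integral_complex_of_real)
  also have "\<dots> = complex_of_real (measure unit_lebesgue A)"
    using assms sets.sets_into_space[OF assms] by (simp add: Int_absorb2)
  finally show ?thesis .
qed

text \<open>
  Exponential decay of correlations. By duality the power of the doubling map turns into a power of
  the transfer operator acting on the indicator of \<open>A\<close>, and this power is uniformly within
  \<open>V (1/2)^n\<close> of its mean.
\<close>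

lemma measure_inter_preimage_close:
  assumes A: "A \<in> sets unit_lebesgue" and B: "B \<in> sets unit_lebesgue"
    and V: "variation_le (indicator A) V"
  shows "\<bar>measure unit_lebesgue (A \<inter> ((doubling_map ^^ n) -` B \<inter> space unit_lebesgue)) -
    measure unit_lebesgue A * measure unit_lebesgue B\<bar> \<le> V * (1/2) ^ n"
proof -
  let ?f = "(doubling_transfer ^^ n) (indicator A)" and ?X = "(doubling_map ^^ n) -` B \<inter> space unit_lebesgue"
  have X: "?X \<in> sets unit_lebesgue"
    using B by (rule measurable_sets[OF doubling_map_funpow_measurable])
  have ind: "indicator A \<in> borel_measurable unit_lebesgue" "cmod (indicator A x) \<le> 1" for x
    using A by (auto split: split_indicator)
  have indB: "indicator B \<in> borel_measurable unit_lebesgue" "cmod (indicator B x) \<le> 1" for x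
    using B by (auto split: split_indicator)
  note L = doubling_transfer_funpow[OF ind V, of n]
  have f_int: "integrable unit_lebesgue ?f"
    using L by (intro U.integrable_const_bound[of _ 1] AE_I2) auto
  have fB_int: "integrable unit_lebesgue (\<lambda>x. ?f x * indicator B x)"
    using L B by (intro U.integrable_const_bound[of _ 1] AE_I2) (auto split: split_indicator)
  have B_int: "integrable unit_lebesgue (indicator B :: real \<Rightarrow> complex)"
    using indB by (intro U.integrable_const_bound[of _ 1] AE_I2) auto
  have mean_f: "mean ?f = measure unit_lebesgue A"
    using integral_doubling_transfer_funpow[OF ind V, of "\<lambda>x. 1" 1 n] integral_indicator_complex[OF A]
    by simp
  have "complex_of_real (measure unit_lebesgue (A \<inter> ?X)) = mean (indicator (A \<inter> ?X))"
    using A X by (intro integral_indicator_complex[symmetric]) auto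
  also have "\<dots> = mean (\<lambda>x. indicator A x * indicator B ((doubling_map ^^ n) x))"
    by (intro Bochner_Integration.integral_cong) (auto split: split_indicator)
  also have "\<dots> = mean (\<lambda>x. ?f x * indicator B x)"
    by (rule integral_doubling_transfer_funpow[symmetric, OF ind V indB])
  finally have "complex_of_real (measure unit_lebesgue (A \<inter> ?X) - measure unit_lebesgue A * measure unit_lebesgue B) =
      mean (\<lambda>x. ?f x * indicator B x) - mean ?f * mean (indicator B)"
    by (simp add: mean_f integral_indicator_complex[OF B])
  also have "\<dots> = mean (\<lambda>x. (?f x - mean ?f) * indicator B x)"
    using fB_int B_int by (simp add: left_diff_distrib)
  also have "cmod \<dots> \<le> (LINT x|unit_lebesgue. V * (1/2) ^ n)"
  proof (rule Bochner_Integration.integral_norm_bound_integral)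
    show "integrable unit_lebesgue (\<lambda>x. (?f x - mean ?f) * indicator B x)"
      using fB_int B_int by (simp add: left_diff_distrib)
    fix x assume "x \<in> space unit_lebesgue"
    then have "cmod (?f x - mean ?f) \<le> V * (1/2) ^ n"
      using L by (intro dist_mean_le_variation f_int) auto
    moreover from this have "0 \<le> V * (1/2) ^ n"
      using norm_ge_zero order_trans by blast
    ultimately show "cmod ((?f x - mean ?f) * indicator B x) \<le> V * (1/2) ^ n"
      by (cases "x \<in> B") simp_all
  qed simp
  finally show ?thesis by (simp only: norm_of_real) (simp add: U.prob_space)
qed

text \<open>
  Invariance is the case of the whole interval, whose indicator has variation \<open>0\<close> there.
\<close>

lemma measure_doubling_map_preimage:
  assumes "B \<in> sets unit_lebesgue"
  shows "measure unit_lebesgue ((doubling_map ^^ n) -` B \<inter> space unit_lebesgue) = measure unit_lebesgue B"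
proof -
  have ind: "variation_le (indicator {0..<1}) 0"
    unfolding variation_le_def ordered_points_def by (auto simp: indicator_def intro!: sum_nonpos)
  have "{0..<1} \<in> sets unit_lebesgue"
    using sets.top[of unit_lebesgue] by simp
  from measure_inter_preimage_close[OF this assms ind, of n]
  show ?thesis by (simp add: Int_absorb1)
qed

lemma invariant_measure_doubling_map: "invariant_measure unit_lebesgue doubling_map"
  unfolding invariant_measure_def
  using measure_doubling_map_preimage[of _ 1] by (simp add: U.emeasure_eq_measure)

lemma nonsingular_doubling_map: "nonsingular unit_lebesgue doubling_map"
  using invariant_measure_doubling_map by (simp add: nonsingular_def invariant_measure_def)

lemma sets_unit_lebesgue: "A \<in> sets borel \<Longrightarrow> A \<inter> {0..<1} \<in> sets unit_lebesgue"
  by (auto simp: unit_lebesgue_def sets_restrict_space)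

text \<open>
  For fixed \<open>B\<close> the sets \<open>A\<close> that mix with \<open>B\<close> form a Dynkin system, where countable unions
  are covered by dominated convergence of series. It contains the initial intervals.
\<close>

lemma mixing_doubling_map: "mixing unit_lebesgue doubling_map"
  unfolding mixing_def
proof (intro ballI)
  fix A B assume A: "A \<in> sets unit_lebesgue" and B: "B \<in> sets unit_lebesgue"
  define X where "X n = (doubling_map ^^ n) -` B \<inter> space unit_lebesgue" for n
  have X: "X n \<in> sets unit_lebesgue" for n
    unfolding X_def by (rule measurable_sets[OF doubling_map_funpow_measurable B])
  have mX: "measure unit_lebesgue (X n) = measure unit_lebesgue B" for n
    unfolding X_def by (rule measure_doubling_map_preimage[OF B])
  define Q where "Q A \<longleftrightarrow> (\<lambda>n. measure unit_lebesgue (A \<inter> {0..<1} \<inter> X n)) \<longlonglongrightarrow>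
    measure unit_lebesgue (A \<inter> {0..<1}) * measure unit_lebesgue B" for A
  have stable: "Int_stable (range (\<lambda>a::real. {..a}))"
    by (auto simp: Int_stable_def)
  have Q: "Q A'" if "A' \<in> sigma_sets UNIV (range (\<lambda>a::real. {..a}))" for A'
    using stable subset_Pow_Union[of "range (\<lambda>a::real. {..a})", THEN order_trans, OF Pow_mono[OF subset_UNIV]] that
  proof (induction rule: sigma_sets_induct_disjoint)
    case (basic A')
    then obtain a where a: "A' = {..a}" by blast
    have "indicator (A' \<inter> {0..<1}) = (\<lambda>x. complex_of_real (indicator (A' \<inter> {0..<1}) x))"
      by (auto simp: of_real_indicator)
    moreover have "variation_le (\<lambda>x. complex_of_real (indicator (A' \<inter> {0..<1}) x)) 1"
      by (rule variation_le_antimono_on) (auto simp: a monotone_on_def indicator_def)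
    ultimately have "variation_le (indicator (A' \<inter> {0..<1})) 1" by simp
    note close = measure_inter_preimage_close[OF sets_unit_lebesgue B this, folded X_def]
    have "(\<lambda>n. measure unit_lebesgue (A' \<inter> {0..<1} \<inter> X n) -
        measure unit_lebesgue (A' \<inter> {0..<1}) * measure unit_lebesgue B) \<longlonglongrightarrow> 0"
    proof (rule Lim_null_comparison)
      have "A' \<in> sets borel" using a by simp
      from close[OF this] show "\<forall>\<^sub>F n in sequentially.
        norm (measure unit_lebesgue (A' \<inter> {0..<1} \<inter> X n) -
          measure unit_lebesgue (A' \<inter> {0..<1}) * measure unit_lebesgue B) \<le> 1 * (1/2) ^ n"
        by (intro always_eventually allI) (simp only: real_norm_def)
      show "(\<lambda>n. 1 * (1/2 :: real) ^ n) \<longlonglongrightarrow> 0"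
        by (simp add: LIMSEQ_realpow_zero)
    qed
    then show ?case
      unfolding Q_def by (rule LIM_zero_cancel)
  next
    case empty
    show ?case by (simp add: Q_def)
  next
    case (compl A')
    then have A': "A' \<inter> {0..<1} \<in> sets unit_lebesgue"
      by (intro sets_unit_lebesgue) (simp add: borel_eq_atMost)
    have "measure unit_lebesgue ((UNIV - A') \<inter> {0..<1} \<inter> Y) =
        measure unit_lebesgue Y - measure unit_lebesgue (A' \<inter> {0..<1} \<inter> Y)"
      if "Y \<in> sets unit_lebesgue" for Y
    proof -
      have "(UNIV - A') \<inter> {0..<1} \<inter> Y = Y - A' \<inter> {0..<1} \<inter> Y"
        using sets.sets_into_space[OF that] by auto
      then show ?thesis using that A' by (simp add: U.finite_measure_Diff)
    qed
    from this[OF X] this[OF sets.top] compl(2) mX show ?case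
      by (auto simp: Q_def left_diff_distrib intro!: tendsto_intros)
  next
    case (union A')
    have A': "A' i \<inter> {0..<1} \<in> sets unit_lebesgue" for i
      using union(2) by (intro sets_unit_lebesgue) (auto simp: borel_eq_atMost)
    have sums: "(\<lambda>i. measure unit_lebesgue (A' i \<inter> {0..<1} \<inter> Y)) sums
        measure unit_lebesgue (\<Union>(range A') \<inter> {0..<1} \<inter> Y)"
      if "Y \<in> sets unit_lebesgue" for Y
    proof -
      have "(\<lambda>i. measure unit_lebesgue (A' i \<inter> {0..<1} \<inter> Y)) sums
        measure unit_lebesgue (\<Union>i. A' i \<inter> {0..<1} \<inter> Y)"
        using that A' union(1) by (intro U.finite_measure_UNION) (auto simp: disjoint_family_on_def)
      then show ?thesis by (simp add: Int_UN_distrib2 Int_assoc)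
    qed
    have top: "A \<inter> {0..<1} \<inter> {0..<1::real} = A \<inter> {0..<1}" for A by auto
    have sums1: "(\<lambda>i. measure unit_lebesgue (A' i \<inter> {0..<1})) sums
        measure unit_lebesgue (\<Union>(range A') \<inter> {0..<1})"
      using sums[OF sets.top] by (simp add: top)
    have "((\<lambda>n. \<Sum>i. measure unit_lebesgue (A' i \<inter> {0..<1} \<inter> X n)) \<longlongrightarrow>
        (\<Sum>i. measure unit_lebesgue (A' i \<inter> {0..<1}) * measure unit_lebesgue B)) sequentially"
    proof (rule conjunct2[OF conjunct2[OF tannerys_theorem]])
      show "((\<lambda>n. measure unit_lebesgue (A' i \<inter> {0..<1} \<inter> X n)) \<longlongrightarrow>
        measure unit_lebesgue (A' i \<inter> {0..<1}) * measure unit_lebesgue B) sequentially" for i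
        using union(3)[of i] by (simp add: Q_def)
      show "eventually (\<lambda>(i, n). norm (measure unit_lebesgue (A' i \<inter> {0..<1} \<inter> X n)) \<le>
          measure unit_lebesgue (A' i \<inter> {0..<1})) (at_top \<times>\<^sub>F sequentially)"
        using A' by (intro always_eventually) (auto intro: U.finite_measure_mono)
      show "summable (\<lambda>i. measure unit_lebesgue (A' i \<inter> {0..<1}))"
        using sums1 by (rule sums_summable)
    qed simp
    then show ?case
      unfolding Q_def
      using sums_unique[OF sums[OF X]] sums_unique[OF sums_mult2[OF sums1, of "measure unit_lebesgue B"]]
      by simp
  qed
  obtain A' where "A' \<in> sets borel" "A = A' \<inter> {0..<1}"
    using A by (auto simp: unit_lebesgue_def sets_restrict_space)
  then show "(\<lambda>n. measure unit_lebesgue (A \<inter> ((doubling_map ^^ n) -` B \<inter> space unit_lebesgue)))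
      \<longlonglongrightarrow> measure unit_lebesgue A * measure unit_lebesgue B"
    using Q[of A'] by (simp add: Q_def X_def borel_eq_atMost)
qed

lemma property_C_doubling_map: "property_C unit_lebesgue doubling_map bv_space bv_norm"
  unfolding property_C_def
  by (intro conjI allI ballI nonsingular_doubling_map function_banach_algebra_bv prob_space_unit_lebesgue
      invariant_measure_doubling_map mixing_doubling_map bv_space_const ess_norm_le_bv_norm
      bounded_linear_op_transfer spectral_gap_transfer)

section \<open>Truncations of a power singularity\<close>

lemma AE_unit_lebesgue_pos: "AE x in unit_lebesgue. 0 < x \<and> x < 1"
proof -
  have "AE x in lborel. x \<in> {0..<1::real} \<longrightarrow> 0 < x \<and> x < 1"
    using AE_lborel_singleton[of "0::real"] by eventually_elim auto
  then show ?thesis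
    unfolding unit_lebesgue_def by (subst AE_restrict_space_iff) simp
qed

lemma bv_version_monotone:
  fixes u :: "real \<Rightarrow> real"
  assumes meas: "u \<in> borel_measurable unit_lebesgue"
    and u: "mono_on {0..<1} u \<or> antimono_on {0..<1} u" "\<And>x. x \<in> {0..<1} \<Longrightarrow> u x \<in> {0..c}"
    and ae: "AE x in unit_lebesgue. f x = of_real (u x)"
  shows "bv_version f (\<lambda>x. of_real (u x)) c c"
  using assms variation_le_mono_on[of u c] variation_le_antimono_on[of u c]
  by (auto simp: bv_version_def ae_eq_def)

lemma powr_neg_antimono:
  assumes "\<gamma> > 0" "0 < x" "x \<le> y"
  shows "y powr (- \<gamma>) \<le> x powr (- \<gamma> :: real)"
  using assms by (intro powr_mono2') auto

text \<open>
  For \<open>l > 1\<close> a truncation jumps where \<open>x^(-\<gamma>) = l\<close> and is not monotone. It is the product of the decreasing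
  function \<open>min (x^(-\<gamma>)) l\<close> and the increasing indicator of \<open>x^(-\<gamma>) \<le> l\<close>, to which the Leibniz
  rule applies.
\<close>

lemma property_D_power_singularity:
  fixes \<gamma> :: real and chi :: "real \<Rightarrow> real"
  assumes \<gamma>: "\<gamma> > 0"
    and chi: "\<And>x. 0 < x \<Longrightarrow> x < 1 \<Longrightarrow> chi x = x powr (- \<gamma>)"
    and chi0: "chi 0 \<ge> 0"
  shows "property_D unit_lebesgue doubling_map bv_space bv_norm chi"
proof -
  have meas: "(\<lambda>x. if x = 0 then c else x powr (- \<gamma>)) \<in> borel_measurable unit_lebesgue" for c
    unfolding unit_lebesgue_def by (intro measurable_restrict_space1) measurable
  have chi_meas [measurable]: "chi \<in> borel_measurable unit_lebesgue"
    using meas[of "chi 0"] by (rule measurable_cong[THEN iffD1, rotated]) (auto simp: chi)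
  have below: "(\<lambda>x. complex_of_real (chi x) * indicator {y. chi y \<le> l} x) \<in> bv_space \<and>
      bv_norm (\<lambda>x. complex_of_real (chi x) * indicator {y. chi y \<le> l} x) \<le> 3 * l"
    if l: "l \<ge> 0" for l
  proof -
    \<comment> \<open>the point \<open>0\<close> is null, and its values are chosen to preserve monotonicity\<close>
    define p where "p x = (if x = 0 then l else min (x powr (- \<gamma>)) l)" for x
    define q where "q x = (if x = 0 then 0 else if x powr (- \<gamma>) \<le> l then 1 else 0 :: real)" for x
    have pm: "p \<in> borel_measurable unit_lebesgue" "q \<in> borel_measurable unit_lebesgue"
      unfolding unit_lebesgue_def p_def q_def by (intro measurable_restrict_space1; measurable)+
    have anti: "antimono_on {0..<1} p"
    proof (rule monotone_onI)
      fix x y :: real assume "x \<in> {0..<1}" "y \<in> {0..<1}" "x \<le> y"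
      then show "p y \<le> p x"
        using powr_neg_antimono[OF \<gamma>, of x y] by (cases "x = 0") (simp_all add: p_def min.mono)
    qed
    have p: "bv_version (\<lambda>x. of_real (p x)) (\<lambda>x. of_real (p x)) l l"
      using l by (intro bv_version_monotone pm disjI2 anti) (auto simp: p_def)
    have mono: "mono_on {0..<1} q"
    proof (rule monotone_onI)
      fix x y :: real assume "x \<in> {0..<1}" "y \<in> {0..<1}" "x \<le> y"
      then show "q x \<le> q y"
        using powr_neg_antimono[OF \<gamma>, of x y] by (cases "x = 0") (auto simp: q_def)
    qed
    have q: "bv_version (\<lambda>x. of_real (q x)) (\<lambda>x. of_real (q x)) 1 1"
      by (intro bv_version_monotone pm disjI1 mono) (auto simp: q_def)
    let ?h = "\<lambda>x. complex_of_real (chi x) * indicator {y. chi y \<le> l} x"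
    have "ae_eq unit_lebesgue ?h (\<lambda>x. of_real (p x) * of_real (q x))"
      using AE_unit_lebesgue_pos unfolding ae_eq_def
      by eventually_elim (auto simp: p_def q_def chi indicator_def)
    then have h: "bv_version ?h (\<lambda>x. of_real (p x) * of_real (q x)) (l * 1) (l * 1 + 1 * l)"
      using bv_version_mult[OF p q] bv_version_cong by blast
    have "?h \<in> borel_measurable unit_lebesgue"
      unfolding indicator_def[abs_def] by measurable
    then show ?thesis using bv_spaceI[OF _ h] bv_norm_le[OF h] by simp
  qed
  have above: "(indicator {y. chi y > l} :: real \<Rightarrow> complex) \<in> bv_space \<and>
      bv_norm (indicator {y. chi y > l}) \<le> 3" for l
  proof -
    define q where "q x = (if x = 0 then 1 else if x powr (- \<gamma>) > l then 1 else 0 :: real)" for x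
    have qm: "q \<in> borel_measurable unit_lebesgue"
      unfolding unit_lebesgue_def q_def by (intro measurable_restrict_space1) measurable
    have ae: "AE x in unit_lebesgue. indicator {y. chi y > l} x = complex_of_real (q x)"
      using AE_unit_lebesgue_pos by eventually_elim (auto simp: q_def chi)
    have anti: "antimono_on {0..<1} q"
      using powr_neg_antimono[OF \<gamma>]
      by (auto simp: monotone_on_def q_def intro: order.strict_trans2)
    have v: "bv_version (indicator {y. chi y > l}) (\<lambda>x. complex_of_real (q x)) 1 1"
      by (intro bv_version_monotone qm ae disjI2 anti) (auto simp: q_def)
    have "(indicator {y. chi y > l} :: real \<Rightarrow> complex) \<in> borel_measurable unit_lebesgue"
      unfolding indicator_def[abs_def] by measurable
    then show ?thesis using bv_spaceI[OF _ v] bv_norm_le[OF v] by simp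
  qed
  have "0 \<le> chi x" if "x \<in> space unit_lebesgue" for x
    using that chi[of x] chi0 by (cases "x = 0") auto
  then show ?thesis
    unfolding property_D_def
    using property_C_doubling_map chi_meas below above
    by (intro conjI exI[of _ "3::real"]) auto
qed

section \<open>Trimmed sums near the singularity\<close>

lemma doubling_map_funpow_small:
  assumes "0 \<le> x" "2 ^ k * x < 1"
  shows "(doubling_map ^^ k) x = 2 ^ k * x"
  using assms(2)
proof (induction k)
  case (Suc k)
  then have "2 ^ k * x < 1/2" by simp
  then show ?case
    using Suc.IH assms(1) doubling_map_eq[of "2 ^ k * x"] by simp
qed simp

text \<open>
  A point \<open>x\<close> with \<open>2^n x < 1\<close> has the monotone orbit \<open>x, 2x, ..., 2^(n-1) x\<close>. All \<open>n\<close>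
  observations are then at least of order \<open>1/x\<close>, so removing fewer than \<open>n\<close> of them does not help.
\<close>

lemma trimmed_sum_near_zero:
  fixes \<gamma> :: real and chi :: "real \<Rightarrow> real"
  assumes \<gamma>: "\<gamma> \<ge> 1"
    and chi: "\<And>x. 0 < x \<Longrightarrow> x < 1 \<Longrightarrow> chi x = x powr (- \<gamma>)"
    and x: "0 < x" "2 ^ n * x < 1" and b: "b < n"
  shows "1 / (2 ^ n * x) \<le> trimmed_sum doubling_map chi n b x"
proof -
  have le: "2 ^ k * x \<le> 2 ^ n * x" if "k \<le> n" for k
    using x that by (intro mult_right_mono power_increasing) auto
  have val: "chi ((doubling_map ^^ k) x) = (2 ^ k * x) powr (- \<gamma>)" if "k \<le> n" for k
    using x(1) order.strict_trans1[OF le[OF that] x(2)]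
      doubling_map_funpow_small[of x k] chi[of "2 ^ k * x"] by simp
  have "decreasing_ordering doubling_map chi n x (\<lambda>i. i - 1)"
    unfolding decreasing_ordering_def
  proof (intro conjI ballI impI)
    show "bij_betw (\<lambda>i. i - 1) {1..n} {0..<n}"
      by (rule bij_betw_byWitness[where f' = Suc]) auto
    fix i j assume ij: "i \<in> {1..n}" "j \<in> {1..n}" "i \<le> j"
    have "(2 ^ (j - 1) * x) powr (- \<gamma>) \<le> (2 ^ (i - 1) * x) powr (- \<gamma>)"
      using \<gamma> x ij by (intro powr_neg_antimono mult_right_mono power_increasing) auto
    then show "chi ((doubling_map ^^ (j - 1)) x) \<le> chi ((doubling_map ^^ (i - 1)) x)"
      using ij by (subst (1 2) val) auto
  qed
  then obtain \<sigma> where \<sigma>: "decreasing_ordering doubling_map chi n x \<sigma>"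
    "trimmed_sum doubling_map chi n b x = (\<Sum>k = b + 1..n. chi ((doubling_map ^^ \<sigma> k) x))"
    unfolding trimmed_sum_def Let_def by (metis someI)
  have range: "\<sigma> k < n" if "k \<in> {1..n}" for k
    using \<sigma>(1) that unfolding decreasing_ordering_def bij_betw_def by auto
  have "1 / (2 ^ n * x) = (2 ^ n * x) powr (- 1)"
    using x by (simp add: powr_minus_divide)
  also have "\<dots> \<le> (2 ^ n * x) powr (- \<gamma>)"
    using \<gamma> x by (intro powr_mono') auto
  also have "\<dots> \<le> (2 ^ \<sigma> n * x) powr (- \<gamma>)"
    using \<gamma> x b range[of n] by (intro powr_neg_antimono le) auto
  also have "\<dots> = chi ((doubling_map ^^ \<sigma> n) x)"
    using b range[of n] by (intro val[symmetric]) auto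
  also have "\<dots> \<le> (\<Sum>k = b + 1..n. chi ((doubling_map ^^ \<sigma> k) x))"
  proof (rule member_le_sum)
    fix k assume "k \<in> {b + 1..n} - {n}"
    then have "\<sigma> k \<le> n" using range[of k] by auto
    then show "0 \<le> chi ((doubling_map ^^ \<sigma> k) x)" by (simp add: val)
  qed (use b in auto)
  finally show ?thesis using \<sigma>(2) by simp
qed

lemma nn_integral_inverse_interval:
  fixes a \<delta> :: real
  assumes "0 < a" "a \<le> \<delta>"
  shows "(\<integral>\<^sup>+ x. ennreal (1 / x) * indicator {a..\<delta>} x \<partial>lborel) = ennreal (ln \<delta> - ln a)"
proof (rule nn_integral_FTC_Icc)
  show "(\<lambda>x::real. 1 / x) \<in> borel_measurable borel" by measurable
  fix x assume "x \<in> {a..\<delta>}"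
  then show "DERIV ln x :> 1 / x" "0 \<le> 1 / x"
    using assms DERIV_ln_divide[of x] by auto
qed (use assms in auto)

lemma nn_integral_trimmed_sum_infinite:
  fixes \<gamma> :: real and chi :: "real \<Rightarrow> real"
  assumes \<gamma>: "\<gamma> \<ge> 1"
    and chi: "\<And>x. 0 < x \<Longrightarrow> x < 1 \<Longrightarrow> chi x = x powr (- \<gamma>)" and b: "b < n"
  shows "(\<integral>\<^sup>+ x. ennreal (trimmed_sum doubling_map chi n b x) \<partial>unit_lebesgue) = \<infinity>"
proof -
  let ?I = "\<integral>\<^sup>+ x. ennreal (trimmed_sum doubling_map chi n b x) \<partial>unit_lebesgue"
  define \<delta> :: real where "\<delta> = 1 / 2 ^ Suc n"
  have \<delta>: "0 < \<delta>" "2 ^ n * \<delta> < 1" "\<delta> < 1"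
  proof -
    have "1 < 2 * (2::real) ^ n" using one_le_power[of "2 :: real" n] by linarith
    then show "0 < \<delta>" "2 ^ n * \<delta> < 1" "\<delta> < 1" by (simp_all add: \<delta>_def)
  qed
  have lower: "ennreal (real m / 2 ^ n) \<le> ?I" for m
  proof -
    \<comment> \<open>the left end point that makes the integral of \<open>1 / x\<close> equal to \<open>m\<close>\<close>
    define a where "a = \<delta> * exp (- real m)"
    have a: "0 < a" "a \<le> \<delta>" "ln \<delta> - ln a = m"
      using \<delta> by (simp_all add: a_def ln_mult)
    have "ennreal (real m / 2 ^ n) = ennreal (1 / 2 ^ n) * ennreal (ln \<delta> - ln a)"
      by (simp add: a(3) flip: ennreal_mult)
    also have "\<dots> = (\<integral>\<^sup>+ x. ennreal (1 / 2 ^ n) * (ennreal (1 / x) * indicator {a..\<delta>} x) \<partial>lborel)"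
      using nn_integral_inverse_interval[OF a(1,2)] by (simp add: nn_integral_cmult)
    also have "\<dots> \<le> (\<integral>\<^sup>+ x. ennreal (trimmed_sum doubling_map chi n b x) * indicator {0..<1} x \<partial>lborel)"
    proof (rule nn_integral_mono)
      fix x :: real
      show "ennreal (1 / 2 ^ n) * (ennreal (1 / x) * indicator {a..\<delta>} x)
          \<le> ennreal (trimmed_sum doubling_map chi n b x) * indicator {0..<1} x"
      proof (cases "x \<in> {a..\<delta>}")
        case True
        then have x: "0 < x" "x < 1" using a \<delta> by auto
        have "2 ^ n * x \<le> 2 ^ n * \<delta>" using True by simp
        then have "2 ^ n * x < 1" using \<delta>(2) by (rule order.strict_trans1)
        then have "ennreal (1 / (2 ^ n * x)) \<le> ennreal (trimmed_sum doubling_map chi n b x)"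
          by (intro ennreal_leI trimmed_sum_near_zero[OF \<gamma> chi x(1) _ b])
        then show ?thesis using True x by (simp flip: ennreal_mult)
      qed simp
    qed
    also have "\<dots> = ?I"
      by (simp add: unit_lebesgue_def nn_integral_restrict_space)
    finally show ?thesis .
  qed
  show ?thesis
  proof (cases ?I)
    case (real r)
    obtain m :: nat where "real m > r * 2 ^ n" using reals_Archimedean2 by blast
    then have "r < real m / 2 ^ n" by (simp add: field_simps)
    then show ?thesis using lower[of m] real by (simp add: ennreal_le_iff)
  qed simp
qed

theorem theorem1p10:
  fixes \<gamma> :: real and chi :: "real \<Rightarrow> real"
  assumes "\<gamma> > 1"
    and "\<And>x. 0 < x \<Longrightarrow> x < 1 \<Longrightarrow> chi x = x powr (- \<gamma>)"
    and "chi 0 > 0"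
  shows "(\<exists>F nrm. property_D unit_lebesgue doubling_map F nrm chi) \<and>
    (\<forall>b :: nat \<Rightarrow> nat.
       filterlim b at_top sequentially \<longrightarrow>
       (\<lambda>n. real (b n)) \<in> o(\<lambda>n. real n) \<longrightarrow>
       (\<forall>n\<ge>1. b n < n \<longrightarrow>
          (\<integral>\<^sup>+ x. ennreal (trimmed_sum doubling_map chi n (b n) x) \<partial>unit_lebesgue) = \<infinity>))"
proof (intro conjI exI allI impI)
  show "property_D unit_lebesgue doubling_map bv_space bv_norm chi"
    using assms by (intro property_D_power_singularity[of \<gamma>]) auto
  fix b :: "nat \<Rightarrow> nat" and n :: nat
  assume "b n < n"
  then show "(\<integral>\<^sup>+ x. ennreal (trimmed_sum doubling_map chi n (b n) x) \<partial>unit_lebesgue) = \<infinity>"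
    using assms by (intro nn_integral_trimmed_sum_infinite[of \<gamma>]) auto
qed

end
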